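(* Let $S\subset\mathbb{R}^3$ be a topological sphere smoothly embedded in $\mathbb{R}^3$, all of whose normal curvatures are at most $1$ in absolute value. Suppose that $S$ is contained in an open ball of radius $2$. Then the region bounded by $S$ contains a ball of radius $1$.
   Context: $\mathbb{R}^3$ carries the standard Euclidean metric. By the Jordan–Brouwer separation theorem $\mathbb{R}^3\setminus S$ has exactly one bounded component $U$. The "region bounded by $S$" is the compact set $U\cup S$, and "ball of radius $1$" means a closed ball. "Normal curvatures absolutely bounded by $1$" means that at every point of $S$ and in every unit tangent direction $v$, the second fundamental form satisfies $|\mathrm{II}(v,v)|\le 1$. *)

theory Defs
  imports "HOL-Analysis.Analysis"
begin

fun Ck_on :: "nat \<Rightarrow> ('a::real_normed_vector \<Rightarrow> 'b::real_normed_vector) \<Rightarrow> 'a set \<Rightarrow> bool" where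
  "Ck_on 0 f U \<longleftrightarrow> continuous_on U f"
| "Ck_on (Suc k) f U \<longleftrightarrow> (\<forall>x\<in>U. f differentiable (at x)) \<and>
     (\<forall>a. Ck_on k (\<lambda>x. frechet_derivative f (at x) a) U)"

text \<open>\<open>Ck_on\<close> takes directional derivatives in all fixed directions; on open subsets of
  finite-dimensional spaces, the only use below, this is the usual class \<open>C\<^sup>k\<close>.\<close>

definition smooth_on :: "('a::euclidean_space \<Rightarrow> 'b::euclidean_space) \<Rightarrow> 'a set \<Rightarrow> bool" where
  "smooth_on f U \<longleftrightarrow> (\<forall>k. Ck_on k f U)"

definition local_parametrization ::
    "(real^3) set \<Rightarrow> (real^2) set \<Rightarrow> (real^2 \<Rightarrow> real^3) \<Rightarrow> bool" where
  "local_parametrization S U X \<longleftrightarrow>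
     open U \<and> smooth_on X U \<and>
     (\<forall>u\<in>U. inj (frechet_derivative X (at u))) \<and>
     (\<exists>Y. homeomorphism U (X ` U) X Y) \<and>
     openin (top_of_set S) (X ` U)"

definition smooth_embedded_surface :: "(real^3) set \<Rightarrow> bool" where
  "smooth_embedded_surface S \<longleftrightarrow>
     (\<forall>p\<in>S. \<exists>U X. local_parametrization S U X \<and> p \<in> X ` U)"

definition unit_normal :: "(real^2 \<Rightarrow> real^3) \<Rightarrow> real^2 \<Rightarrow> real^3 \<Rightarrow> bool" where
  "unit_normal X u n \<longleftrightarrow> norm n = 1 \<and> (\<forall>a. n \<bullet> frechet_derivative X (at u) a = 0)"

text \<open>The second fundamental form at \<open>X u\<close> with respect to the unit normal \<open>n\<close>, in the
  coordinates of the parametrization \<open>X\<close>: it is \<open>II(v, w)\<close> for the tangent vectors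
  \<open>v = dX\<^sub>u(a)\<close> and \<open>w = dX\<^sub>u(b)\<close>. For the coordinate vectors of \<open>real^2\<close> it gives the
  usual coefficients, the inner products of \<open>n\<close> with the second partial derivatives of \<open>X\<close>.\<close>

definition second_fundamental_form ::
    "(real^2 \<Rightarrow> real^3) \<Rightarrow> real^2 \<Rightarrow> real^3 \<Rightarrow> real^2 \<Rightarrow> real^2 \<Rightarrow> real" where
  "second_fundamental_form X u n a b =
     n \<bullet> frechet_derivative (\<lambda>x. frechet_derivative X (at x) a) (at u) b"

text \<open>The value \<open>II(v, v)\<close> does not depend on the parametrization, and replacing \<open>n\<close> by
  \<open>- n\<close> only changes its sign, so quantifying over all parametrizations and both unit
  normals imposes one bound for each point and each unit tangent vector
  \<open>v = dX\<^sub>u(a)\<close>.\<close>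

definition normal_curvatures_bounded_by :: "(real^3) set \<Rightarrow> real \<Rightarrow> bool" where
  "normal_curvatures_bounded_by S K \<longleftrightarrow>
     (\<forall>U X u n a. local_parametrization S U X \<and> u \<in> U \<and> unit_normal X u n \<and>
        norm (frechet_derivative X (at u) a) = 1 \<longrightarrow>
        \<bar>second_fundamental_form X u n a a\<bar> \<le> K)"

text \<open>\<open>inside S\<close> is the union of the bounded components of the complement of \<open>S\<close>; for a
  topological sphere there is exactly one.\<close>

definition region_bounded_by :: "(real^3) set \<Rightarrow> (real^3) set" where
  "region_bounded_by S = inside S \<union> S"

end

theory Submission
  imports Defs
begin

text \<open>
  Let \<open>S\<close> lie in the closed ball of radius \<open>2 r\<close> about \<open>c\<close>, where \<open>r < 1\<close>. Over all points \<open>p\<close> and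
  unit normals \<open>n\<close>, a maximum of \<open>|p - c|\<^sup>2 - 2 r |n \<bullet> (p - c)|\<close> can only occur where \<open>p - c\<close> is parallel
  to \<open>n\<close>, because elsewhere moving \<open>p\<close> along the tangential part of \<open>p - c\<close> increases it: this is
  where the curvature bound enters. Hence the maximum is at most \<open>0\<close>. So \<open>S\<close> is transversal to the
  rays from \<open>c\<close>, its interior is star-shaped about \<open>c\<close>, and for the outward normal the points
  \<open>p - r n\<close> lie in the closed ball of radius \<open>r\<close> about \<open>c\<close>.

  Now let \<open>p\<close> be a point of \<open>S\<close> farthest from the given centre, with outward normal \<open>u\<close>, and take
  \<open>c = p - 2 r u\<close>. Inflate a ball inside \<open>S\<close> that touches \<open>S\<close> at \<open>p\<close>. If, at a radius \<open>T < r\<close>, it touches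
  \<open>S\<close> at a further point with normal \<open>m\<close>, then its centre \<open>x = p - T u\<close> has distance \<open>2 r - T\<close> from \<open>c\<close>
  and \<open>x - (r - T) m\<close> has distance at most \<open>r\<close> from \<open>c\<close>, which forces \<open>m = u\<close>. A quantitative form of
  this rigidity shows that every such ball of radius \<open>T < 1\<close> avoids \<open>S\<close>.
\<close>

section \<open>Derivatives of smooth maps\<close>

abbreviation fderiv :: "('a::euclidean_space \<Rightarrow> 'b::euclidean_space) \<Rightarrow> 'a \<Rightarrow> 'a \<Rightarrow> 'b" where
  "fderiv f x \<equiv> frechet_derivative f (at x)"

lemma smooth_on_has_derivative:
  assumes "smooth_on f U" "x \<in> U"
  shows "(f has_derivative fderiv f x) (at x)"
proof -
  have "Ck_on (Suc 0) f U"
    using assms(1) unfolding smooth_on_def by blast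
  then show ?thesis
    using assms(2) by (simp add: frechet_derivative_works)
qed

lemma has_vector_derivative_along_line:
  fixes f :: "'a::real_normed_vector \<Rightarrow> 'b::real_normed_vector"
  assumes "(f has_derivative f') (at x)"
  shows "((\<lambda>t. f (x + t *\<^sub>R a)) has_vector_derivative f' a) (at 0)"
proof -
  interpret bounded_linear f'
    using assms by (rule has_derivative_bounded_linear)
  have "((\<lambda>t::real. x + t *\<^sub>R a) has_derivative (\<lambda>t. t *\<^sub>R a)) (at 0)"
    by (auto intro!: derivative_eq_intros)
  moreover have "(f has_derivative f') (at (x + 0 *\<^sub>R a))"
    using assms by simp
  ultimately have "((\<lambda>t. f (x + t *\<^sub>R a)) has_derivative (\<lambda>t. f' (t *\<^sub>R a))) (at 0)"
    by (rule has_derivative_compose)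
  then show ?thesis
    by (simp only: has_vector_derivative_def scaleR)
qed

lemma smooth_on_fderiv:
  assumes "smooth_on f U"
  shows "smooth_on (\<lambda>x. fderiv f x a) U"
  unfolding smooth_on_def
proof
  fix k
  have "Ck_on (Suc k) f U"
    using assms unfolding smooth_on_def by blast
  then show "Ck_on k (\<lambda>x. fderiv f x a) U"
    by simp
qed

lemma smooth_on_imp_continuous_on:
  assumes "smooth_on f U"
  shows "continuous_on U f"
proof -
  have "Ck_on 0 f U"
    using assms unfolding smooth_on_def by blast
  then show ?thesis
    by simp
qed

text \<open>Near \<open>u\<close> the differential is within \<open>e\<close> of
  \<open>fderiv f u\<close> in operator norm, because its values on the basis vectors are
  continuous. The mean value inequality for the difference of \<open>f\<close> and
  \<open>fderiv f u\<close> does the rest.\<close>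

lemma smooth_on_strictly_differentiable:
  fixes f :: "'a::euclidean_space \<Rightarrow> 'b::euclidean_space"
  assumes "open U" "smooth_on f U" "u \<in> U" "e > 0"
  obtains d where "d > 0" "ball u d \<subseteq> U"
    "\<And>x y. \<lbrakk>x \<in> ball u d; y \<in> ball u d\<rbrakk>
       \<Longrightarrow> norm (f y - f x - fderiv f u (y - x)) \<le> e * norm (y - x)"
proof -
  define \<eta> where "\<eta> = e / DIM('a)"
  have "\<eta> > 0"
    using assms(4) by (simp add: \<eta>_def)
  have "\<forall>\<^sub>F x in at u. \<forall>i\<in>Basis. dist (fderiv f x i) (fderiv f u i) < \<eta>"
  proof (intro eventually_ball_finite ballI)
    fix i :: 'a
    have "continuous_on U (\<lambda>x. fderiv f x i)"
      by (intro smooth_on_imp_continuous_on smooth_on_fderiv assms)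
    then have "((\<lambda>x. fderiv f x i) \<longlongrightarrow> fderiv f u i) (at u)"
      using assms(1,3) by (simp add: continuous_on_eq_continuous_at isCont_def)
    then show "\<forall>\<^sub>F x in at u. dist (fderiv f x i) (fderiv f u i) < \<eta>"
      using \<open>\<eta> > 0\<close> by (rule tendstoD)
  qed simp
  then obtain d1 where d1: "d1 > 0"
    "\<And>x i. \<lbrakk>x \<noteq> u; dist x u < d1; i \<in> Basis\<rbrakk> \<Longrightarrow> dist (fderiv f x i) (fderiv f u i) < \<eta>"
    unfolding eventually_at by blast
  have close: "dist (fderiv f x i) (fderiv f u i) < \<eta>" if "dist x u < d1" "i \<in> Basis" for x i
    using d1(2)[of x i] that \<open>\<eta> > 0\<close> by (cases "x = u") auto
  obtain d2 where d2: "d2 > 0" "ball u d2 \<subseteq> U"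
    using assms(1,3) openE by blast
  define d where "d = min d1 d2"
  have dU: "ball u d \<subseteq> U"
    using d2 by (auto simp: d_def)
  have lin: "bounded_linear (fderiv f x)" if "x \<in> U" for x
    using smooth_on_has_derivative[OF assms(2) that] by (rule has_derivative_bounded_linear)
  have on: "onorm (\<lambda>v. fderiv f x v - fderiv f u v) \<le> e" if x: "x \<in> ball u d" for x
  proof (rule onorm_le)
    fix v :: 'a
    have expand: "fderiv f z v = (\<Sum>i\<in>Basis. (v \<bullet> i) *\<^sub>R fderiv f z i)" if "z \<in> U" for z
    proof -
      interpret bounded_linear "fderiv f z" using lin[OF that] .
      have "fderiv f z v = fderiv f z (\<Sum>i\<in>Basis. (v \<bullet> i) *\<^sub>R i)"
        by (simp add: euclidean_representation)
      then show ?thesis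
        by (simp add: sum scaleR)
    qed
    have "norm (fderiv f x v - fderiv f u v)
        = norm (\<Sum>i\<in>Basis. (v \<bullet> i) *\<^sub>R (fderiv f x i - fderiv f u i))"
      using x dU assms(3) by (simp add: expand subset_iff sum_subtractf scaleR_diff_right)
    also have "\<dots> \<le> (\<Sum>i\<in>(Basis::'a set). norm v * \<eta>)"
    proof (rule sum_norm_le)
      fix i :: 'a assume i: "i \<in> Basis"
      have "norm (fderiv f x i - fderiv f u i) \<le> \<eta>"
      proof -
        have "dist x u < d1"
          using x by (simp add: d_def dist_commute)
        from close[OF this i] show ?thesis
          by (simp add: dist_norm)
      qed
      moreover have "\<bar>v \<bullet> i\<bar> \<le> norm v"
        using i by (rule Basis_le_norm)
      ultimately show "norm ((v \<bullet> i) *\<^sub>R (fderiv f x i - fderiv f u i)) \<le> norm v * \<eta>"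
        by (simp add: mult_mono)
    qed
    also have "\<dots> = e * norm v"
      by (simp add: \<eta>_def)
    finally show "norm (fderiv f x v - fderiv f u v) \<le> e * norm v" .
  qed
  have "norm (f y - f x - fderiv f u (y - x)) \<le> e * norm (y - x)"
    if "x \<in> ball u d" "y \<in> ball u d" for x y
  proof -
    interpret D: bounded_linear "fderiv f u" using lin[OF assms(3)] .
    have "norm ((f y - fderiv f u y) - (f x - fderiv f u x)) \<le> e * norm (y - x)"
    proof (rule differentiable_bound)
      show "((\<lambda>z. f z - fderiv f u z) has_derivative (\<lambda>v. fderiv f z v - fderiv f u v))
              (at z within ball u d)" if "z \<in> ball u d" for z
        using that dU
        by (intro has_derivative_diff has_derivative_at_withinI[OF smooth_on_has_derivative[OF assms(2)]]
            bounded_linear_imp_has_derivative lin[OF assms(3)]) auto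
    qed (use on that in auto)
    then show ?thesis
      by (simp add: D.diff algebra_simps)
  qed
  then show ?thesis
    using d1(1) d2(1) dU by (intro that[of d]) (auto simp: d_def)
qed

section \<open>Normals of an embedded surface\<close>

text \<open>Whether \<open>n\<close> is normal at \<open>p\<close> does not depend on the chart (\<open>surface_normal_unit_normal\<close>).
  No orientation is chosen: \<open>n\<close> and \<open>- n\<close> are both normals.\<close>

definition surface_normal :: "(real^3) set \<Rightarrow> real^3 \<Rightarrow> real^3 \<Rightarrow> bool" where
  "surface_normal S p n \<longleftrightarrow>
     (\<exists>U X u. local_parametrization S U X \<and> u \<in> U \<and> X u = p \<and> unit_normal X u n)"

lemma surface_normal_norm: "surface_normal S p n \<Longrightarrow> norm n = 1"
  by (auto simp: surface_normal_def unit_normal_def)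

lemma local_parametrization_in: "local_parametrization S U X \<Longrightarrow> u \<in> U \<Longrightarrow> X u \<in> S"
  unfolding local_parametrization_def by (meson imageI in_mono openin_imp_subset)

lemma surface_normal_in: "surface_normal S p n \<Longrightarrow> p \<in> S"
  by (auto simp: surface_normal_def local_parametrization_in)

lemma local_parametrization_linear:
  assumes "local_parametrization S U X" "u \<in> U"
  shows "(X has_derivative fderiv X u) (at u)" "bounded_linear (fderiv X u)" 
    "linear (fderiv X u)" "inj (fderiv X u)"
  using assms smooth_on_has_derivative[of X U u] has_derivative_bounded_linear
    bounded_linear.linear unfolding local_parametrization_def by blast+

lemma local_parametrization_open:
  assumes "local_parametrization S U X" "u \<in> W" "open W" "W \<subseteq> U"
  obtains d where "d > 0" "\<And>q. \<lbrakk>q \<in> S; dist q (X u) < d\<rbrakk> \<Longrightarrow> \<exists>w\<in>W. q = X w"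
proof -
  obtain Y where Y: "homeomorphism U (X ` U) X Y" and o: "openin (top_of_set S) (X ` U)"
    using assms(1) unfolding local_parametrization_def by blast
  have "openin (top_of_set U) W"
    using assms by (simp add: open_subset)
  then have "openin (top_of_set (X ` U)) (X ` W)"
    by (rule homeomorphism_imp_open_map[OF Y])
  then have "openin (top_of_set S) (X ` W)"
    using o openin_trans by blast
  then obtain d where "d > 0" "ball (X u) d \<inter> S \<subseteq> X ` W"
    using assms(2) unfolding openin_contains_ball by blast
  then show ?thesis
    by (intro that[of d]) (auto simp: dist_commute subset_iff image_iff)
qed

text \<open>The bound is stated for two variable points because injectivity of the radial projection
  near \<open>X u\<close> needs more than tangency at \<open>X u\<close> itself.\<close>

lemma unit_normal_secant_bound:
  assumes "local_parametrization S U X" "u \<in> U" "unit_normal X u n" "e > 0"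
  obtains d where "d > 0" "\<And>p q. \<lbrakk>p \<in> S; q \<in> S; dist p (X u) < d; dist q (X u) < d\<rbrakk>
      \<Longrightarrow> \<bar>n \<bullet> (q - p)\<bar> \<le> e * norm (q - p)"
proof -
  note L = local_parametrization_linear[OF assms(1,2)]
  obtain B where B: "B > 0" "\<And>a. B * norm a \<le> norm (fderiv X u a)"
    using linear_inj_bounded_below_pos[OF L(3,4)] by blast
  \<comment> \<open>The first bound keeps \<open>norm (q - p)\<close> at least
    \<open>B/2 * norm v\<close>; the second bounds the linearization error, the only term that
    \<open>n\<close> sees, by \<open>e\<close> times that length.\<close>
  define \<eta> where "\<eta> = min (B/2) (e * B/2)"
  have \<eta>: "\<eta> > 0" "\<eta> \<le> B/2" "\<eta> \<le> e * B/2"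
    using B(1) assms(4) by (auto simp: \<eta>_def)
  obtain r where r: "r > 0" "ball u r \<subseteq> U"
    "\<And>x y. \<lbrakk>x \<in> ball u r; y \<in> ball u r\<rbrakk>
       \<Longrightarrow> norm (X y - X x - fderiv X u (y - x)) \<le> \<eta> * norm (y - x)"
    using smooth_on_strictly_differentiable[of U X u \<eta>] assms(1,2) \<eta>(1)
    unfolding local_parametrization_def by blast
  obtain d where d: "d > 0" "\<And>q. \<lbrakk>q \<in> S; dist q (X u) < d\<rbrakk> \<Longrightarrow> \<exists>w\<in>ball u r. q = X w"
    using local_parametrization_open[OF assms(1), of u "ball u r"] r by auto
  have "\<bar>n \<bullet> (q - p)\<bar> \<le> e * norm (q - p)"
    if pq: "p \<in> S" "q \<in> S" "dist p (X u) < d" "dist q (X u) < d" for p q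
  proof -
    obtain x y where xy: "x \<in> ball u r" "y \<in> ball u r" "p = X x" "q = X y"
      using d(2) pq by meson
    define v where "v = y - x"
    define E where "E = X y - X x - fderiv X u v"
    have E: "norm E \<le> \<eta> * norm v"
      using r(3) xy by (simp add: E_def v_def)
    have qp: "q - p = fderiv X u v + E"
      by (simp add: E_def xy)
    have "n \<bullet> (q - p) = n \<bullet> E"
      using assms(3) by (simp add: qp inner_add_right unit_normal_def)
    also have "\<bar>n \<bullet> E\<bar> \<le> norm n * norm E"
      by (rule Cauchy_Schwarz_ineq2)
    also have "\<dots> \<le> \<eta> * norm v"
      using E assms(3) by (simp add: unit_normal_def)
    also have "\<dots> \<le> e * (B/2 * norm v)"
      using \<eta>(3) mult_right_mono[of \<eta> "e * B / 2" "norm v"] by (simp add: mult_ac)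
    also have "\<dots> \<le> e * norm (q - p)"
    proof (rule mult_left_mono)
      have "B * norm v - \<eta> * norm v \<le> norm (q - p)"
        using norm_diff_ineq[of "fderiv X u v" E] B(2)[of v] E by (simp add: qp)
      moreover have "\<eta> * norm v \<le> B/2 * norm v"
        using \<eta>(2) by (intro mult_right_mono) auto
      ultimately show "B/2 * norm v \<le> norm (q - p)"
        by (simp add: field_simps)
    qed (use assms in auto)
    finally show ?thesis .
  qed
  then show ?thesis
    using d(1) that by blast
qed

text \<open>The tangent vector \<open>fderiv X u b\<close> is a limit of scaled secants of
  \<open>S\<close>. The secant bound, taken in the chart \<open>Z\<close> that witnesses normality,
  makes their inner product with \<open>n\<close> arbitrarily small relative to their
  length.\<close>

lemma surface_normal_unit_normal:
  assumes "surface_normal S (X u) n" "local_parametrization S U X" "u \<in> U"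
  shows "unit_normal X u n"
  unfolding unit_normal_def
proof (intro conjI allI)
  show "norm n = 1"
    using assms(1) by (rule surface_normal_norm)
  fix b
  obtain V Z z where Z: "local_parametrization S V Z" "z \<in> V" "Z z = X u" "unit_normal Z z n"
    using assms(1) unfolding surface_normal_def by blast
  note L = local_parametrization_linear[OF assms(2,3)]
  define f where "f = (\<lambda>t. X (u + t *\<^sub>R b))"
  have f: "(f has_vector_derivative fderiv X u b) (at 0)"
    unfolding f_def by (rule has_vector_derivative_along_line[OF L(1)])
  have f0: "f 0 = X u"
    by (simp add: f_def)
  have quot: "((\<lambda>t. (f t - X u) /\<^sub>R t) \<longlongrightarrow> fderiv X u b) (at 0)"
  proof -
    have "((\<lambda>t. norm (f (0 + t) - f 0 - t *\<^sub>R fderiv X u b) / norm t) \<longlongrightarrow> 0) (at 0)"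
      using f unfolding has_vector_derivative_def has_derivative_at by blast
    moreover have "\<forall>\<^sub>F t in at 0. norm (f (0 + t) - f 0 - t *\<^sub>R fderiv X u b) / norm t
        = norm ((f t - X u) /\<^sub>R t - fderiv X u b)"
    proof (unfold eventually_at_filter, rule always_eventually, intro allI impI)
      fix t :: real assume "t \<noteq> 0"
      then have "(f t - X u) /\<^sub>R t - fderiv X u b = (f (0 + t) - f 0 - t *\<^sub>R fderiv X u b) /\<^sub>R t"
        by (simp add: f0 scaleR_diff_right)
      then show "norm (f (0 + t) - f 0 - t *\<^sub>R fderiv X u b) / norm t
          = norm ((f t - X u) /\<^sub>R t - fderiv X u b)"
        by (simp add: divide_inverse mult.commute)
    qed
    ultimately have "((\<lambda>t. norm ((f t - X u) /\<^sub>R t - fderiv X u b)) \<longlongrightarrow> 0) (at 0)"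
      by (rule Lim_transform_eventually)
    then have "((\<lambda>t. (f t - X u) /\<^sub>R t - fderiv X u b) \<longlongrightarrow> 0) (at 0)"
      by (rule tendsto_norm_zero_cancel)
    then show ?thesis
      by (rule LIM_zero_cancel)
  qed
  have "\<bar>n \<bullet> fderiv X u b\<bar> \<le> e * norm (fderiv X u b)" if "e > 0" for e
  proof -
    obtain d where d: "d > 0" "\<And>p q. \<lbrakk>p \<in> S; q \<in> S; dist p (Z z) < d; dist q (Z z) < d\<rbrakk>
      \<Longrightarrow> \<bar>n \<bullet> (q - p)\<bar> \<le> e * norm (q - p)"
      using unit_normal_secant_bound[OF Z(1,2,4) \<open>e > 0\<close>] by blast
    have "(f \<longlongrightarrow> X u) (at 0)"
      using has_vector_derivative_continuous[OF f] by (simp add: isCont_def f0)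
    then have ev1: "\<forall>\<^sub>F t in at 0. dist (f t) (X u) < d"
      using d(1) by (rule tendstoD)
    have "((\<lambda>t. u + t *\<^sub>R b) \<longlongrightarrow> u + 0 *\<^sub>R b) (at 0)"
      by (intro tendsto_intros)
    then have ev2: "\<forall>\<^sub>F t in at 0. u + t *\<^sub>R b \<in> U"
      using assms(2,3) by (intro topological_tendstoD) (auto simp: local_parametrization_def)
    have "\<forall>\<^sub>F t in at 0. \<bar>n \<bullet> ((f t - X u) /\<^sub>R t)\<bar> \<le> e * norm ((f t - X u) /\<^sub>R t)"
      using ev1 ev2
    proof eventually_elim
      case (elim t)
      have "\<bar>n \<bullet> (f t - X u)\<bar> \<le> e * norm (f t - X u)"
        using d elim local_parametrization_in[OF assms(2)] assms(3) Z(3) by (auto simp: f_def)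
      then have "\<bar>inverse t\<bar> * \<bar>n \<bullet> (f t - X u)\<bar> \<le> \<bar>inverse t\<bar> * (e * norm (f t - X u))"
        by (intro mult_left_mono) auto
      then show ?case
        by (simp add: abs_mult mult_ac)
    qed
    moreover have "((\<lambda>t. \<bar>n \<bullet> ((f t - X u) /\<^sub>R t)\<bar>) \<longlongrightarrow> \<bar>n \<bullet> fderiv X u b\<bar>) (at 0)"
      "((\<lambda>t. e * norm ((f t - X u) /\<^sub>R t)) \<longlongrightarrow> e * norm (fderiv X u b)) (at 0)"
      by (intro tendsto_intros quot)+
    ultimately show ?thesis
      by (intro tendsto_le[of "at 0"]) auto
  qed
  then have "\<bar>n \<bullet> fderiv X u b\<bar> \<le> 0 * norm (fderiv X u b)"
    by (intro tendsto_le[of "at_right 0" "\<lambda>e. e * norm (fderiv X u b)"] tendsto_intros)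
       (auto simp: eventually_at_filter)
  then show "n \<bullet> fderiv X u b = 0"
    by simp
qed

lemma surface_normal_exists:
  assumes "smooth_embedded_surface S" "p \<in> S"
  obtains n where "surface_normal S p n"
proof -
  obtain U X u where X: "local_parametrization S U X" "u \<in> U" "p = X u"
    using assms unfolding smooth_embedded_surface_def by blast
  have "dim (range (fderiv X u)) \<le> dim (UNIV :: (real^2) set)"
    by (rule dim_image_le[OF local_parametrization_linear(3)[OF X(1,2)]])
  then have "dim (range (fderiv X u)) < DIM(real^3)"
    by simp
  then obtain x where "x \<noteq> 0" and x: "\<And>y. y \<in> span (range (fderiv X u)) \<Longrightarrow> orthogonal x y"
    using orthogonal_to_subspace_exists by blast
  have "unit_normal X u (sgn x)"
    unfolding unit_normal_def
  proof (intro conjI allI)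
    fix a
    have "orthogonal x (fderiv X u a)"
      by (intro x span_base) simp
    then show "sgn x \<bullet> fderiv X u a = 0"
      by (simp add: sgn_div_norm orthogonal_def)
  qed (use \<open>x \<noteq> 0\<close> in \<open>simp add: norm_sgn\<close>)
  then show ?thesis
    using X that unfolding surface_normal_def by blast
qed

text \<open>Provides the domain on which a function of points and normals attains its maximum. For
  closedness, the inverse of one chart around the limit point turns convergence of points into
  convergence of parameters, and orthogonality passes to the limit.\<close>

lemma compact_surface_normals:
  assumes "compact S" "smooth_embedded_surface S"
  shows "compact {(p, n). surface_normal S p n}"
proof -
  let ?N = "{(p, n). surface_normal S p n}"
  have "?N \<subseteq> S \<times> sphere 0 1"
    by (auto dest: surface_normal_in surface_normal_norm)
  then have "bounded ?N"
    by (rule bounded_subset[rotated])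
      (intro bounded_Times bounded_sphere compact_imp_bounded[OF assms(1)])
  moreover have "closed ?N"
  proof (unfold closed_sequential_limits, intro allI impI, elim conjE)
    fix z :: "nat \<Rightarrow> (real^3) \<times> (real^3)" and l
    assume z: "\<forall>k. z k \<in> ?N" "z \<longlonglongrightarrow> l"
    define p n P N where "p = fst l" and "n = snd l" and "P = (\<lambda>k. fst (z k))" and "N = (\<lambda>k. snd (z k))"
    have lim: "P \<longlonglongrightarrow> p" "N \<longlonglongrightarrow> n"
      unfolding P_def N_def p_def n_def using z(2) tendsto_fst tendsto_snd by blast+
    have nrm: "surface_normal S (P k) (N k)" for k
      using z(1) by (auto simp: P_def N_def case_prod_beta)
    have "p \<in> S"
      using lim(1) nrm compact_imp_closed[OF assms(1)] closed_sequentially surface_normal_in by metis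
    then obtain U X u where X: "local_parametrization S U X" "u \<in> U" "p = X u"
      using assms(2) unfolding smooth_embedded_surface_def by blast
    then obtain Y where Y: "homeomorphism U (X ` U) X Y"
      unfolding local_parametrization_def by blast
    obtain d where d: "d > 0" "\<And>q. \<lbrakk>q \<in> S; dist q (X u) < d\<rbrakk> \<Longrightarrow> \<exists>w\<in>U. q = X w"
      using local_parametrization_open[OF X(1,2)] X(1)
      unfolding local_parametrization_def by blast
    have ev: "\<forall>\<^sub>F k in sequentially. P k \<in> X ` U"
      using tendstoD[OF lim(1) d(1)]
    proof eventually_elim
      case (elim k)
      then have "dist (P k) (X u) < d"
        using X(3) by simp
      then show ?case
        using d(2)[OF surface_normal_in[OF nrm]] by blast
    qed
    have "continuous_on (X ` U) Y"
      using Y by (simp add: homeomorphism_def)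
    then have Yu: "(\<lambda>k. Y (P k)) \<longlonglongrightarrow> u"
      using continuous_on_tendsto_compose[OF _ lim(1) _ ev, of Y] Y X(2,3)
      by (simp add: homeomorphism_def)
    have zero: "n \<bullet> fderiv X u a = 0" for a
    proof -
      have "isCont (\<lambda>w. fderiv X w a) u"
        using X(1,2) smooth_on_imp_continuous_on[OF smooth_on_fderiv, of X U a]
        unfolding local_parametrization_def by (simp add: continuous_on_eq_continuous_at)
      then have "(\<lambda>k. N k \<bullet> fderiv X (Y (P k)) a) \<longlonglongrightarrow> n \<bullet> fderiv X u a"
        by (intro tendsto_inner lim isCont_tendsto_compose[OF _ Yu])
      moreover have zero: "\<forall>\<^sub>F k in sequentially. N k \<bullet> fderiv X (Y (P k)) a = 0"
        using ev
      proof eventually_elim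
        case (elim k)
        then obtain w where w: "w \<in> U" "P k = X w" by blast
        then have "Y (P k) = w"
          using Y by (simp add: homeomorphism_def)
        then show ?case
          using surface_normal_unit_normal[OF _ X(1) w(1)] nrm[of k] w(2)
          by (simp add: unit_normal_def)
      qed
      ultimately show ?thesis
        using LIMSEQ_unique[OF _ tendsto_eventually[OF zero]] by simp
    qed
    have "norm n = 1"
      using tendsto_norm[OF lim(2)] surface_normal_norm[OF nrm]
      by (simp add: LIMSEQ_const_iff)
    then have "surface_normal S p n"
      using X zero unfolding surface_normal_def unit_normal_def by blast
    then show "l \<in> ?N"
      by (simp add: p_def n_def case_prod_beta)
  qed
  ultimately show ?thesis
    by (simp add: compact_eq_bounded_closed)
qed

text \<open>Extends \<open>n\<close> along a coordinate line by the normalized cross product of the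
  coordinate tangent vectors, up to a constant sign \<open>k\<close>.\<close>

lemma differentiable_unit_normal:
  assumes "local_parametrization S U X" "u \<in> U" "unit_normal X u n"
  obtains N N' where "N 0 = n" "(N has_vector_derivative N') (at 0)"
    "\<forall>\<^sub>F t in nhds 0. u + t *\<^sub>R a \<in> U \<and> unit_normal X (u + t *\<^sub>R a) (N t)"
proof -
  define \<nu> where "\<nu> = (\<lambda>x. cross3 (fderiv X x (axis 1 1)) (fderiv X x (axis 2 1)))"
  have expand: "fderiv X x b = (b $ 1) *\<^sub>R fderiv X x (axis 1 1) + (b $ 2) *\<^sub>R fderiv X x (axis 2 1)"
    if "x \<in> U" for x b
  proof -
    interpret bounded_linear "fderiv X x"
      using local_parametrization_linear[OF assms(1) that] by simp
    have "b = (b $ 1) *\<^sub>R axis 1 1 + (b $ 2) *\<^sub>R axis 2 1"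
      by (simp add: vec_eq_iff forall_2 axis_def)
    then show ?thesis
      using add scaleR by metis
  qed
  have \<nu>_orth: "\<nu> x \<bullet> fderiv X x b = 0" if "x \<in> U" for x b
    by (simp add: \<nu>_def expand[OF that, of b] inner_add_right dot_cross_self)
  have \<nu>_nz: "\<nu> x \<noteq> 0" if x: "x \<in> U" for x
  proof
    assume "\<nu> x = 0"
    interpret bounded_linear "fderiv X x"
      using local_parametrization_linear[OF assms(1) x] by simp
    have inj: "fderiv X x b = 0 \<Longrightarrow> b = 0" for b
      using local_parametrization_linear(4)[OF assms(1) x] zero by (metis injD)
    have "fderiv X x (axis 1 1) \<noteq> 0"
      using inj[of "axis 1 1"] by (auto simp: axis_eq_0_iff)
    moreover have "collinear {0, fderiv X x (axis 1 1), fderiv X x (axis 2 1)}"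
      using \<open>\<nu> x = 0\<close> by (simp add: \<nu>_def cross_eq_0)
    ultimately obtain c where "fderiv X x (axis 2 1) = c *\<^sub>R fderiv X x (axis 1 1)"
      by (auto simp: collinear_lemma)
    then have "fderiv X x (axis 2 1 - c *\<^sub>R axis 1 1) = 0"
      by (simp add: diff scaleR)
    then have "axis 2 1 - c *\<^sub>R axis 1 1 = (0 :: real^2)"
      by (rule inj)
    then have "(axis 2 1 - c *\<^sub>R axis 1 1 :: real^2) $ 2 = 0"
      by simp
    then show False
      by (simp add: axis_def)
  qed
  \<comment> \<open>By the Lagrange formula for the triple product, \<open>n\<close> is parallel to
    \<open>\<nu> u\<close>; hence \<open>k\<close> is 1 or -1.\<close>
  have "cross3 n (\<nu> u) = 0"
    using assms(3) by (simp add: \<nu>_def Lagrange unit_normal_def)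
  then have sq: "(n \<bullet> \<nu> u)\<^sup>2 = (norm (\<nu> u))\<^sup>2"
    using norm_cross_dot[of n "\<nu> u"] assms(3) by (simp add: unit_normal_def)
  define k where "k = (n \<bullet> \<nu> u) / norm (\<nu> u)"
  have k2: "k\<^sup>2 = 1"
    using sq \<nu>_nz[OF assms(2)] by (simp add: k_def power_divide)
  define w where "w = (\<lambda>t. \<nu> (u + t *\<^sub>R a))"
  define N where "N = (\<lambda>t. (k * inverse (norm (w t))) *\<^sub>R w t)"
  have N0: "N 0 = n"
  proof -
    define e where "e = inverse (norm (\<nu> u)) *\<^sub>R \<nu> u"
    have e: "norm e = 1" "n \<bullet> e = k" "N 0 = k *\<^sub>R e"
      using \<nu>_nz[OF assms(2)] by (simp_all add: e_def k_def N_def w_def divide_inverse mult.commute)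
    have "(N 0 - n) \<bullet> (N 0 - n) = k * k * (e \<bullet> e) - k * (e \<bullet> n) - k * (n \<bullet> e) + n \<bullet> n"
      unfolding e(3) by (simp add: inner_diff_left inner_diff_right algebra_simps)
    moreover have "e \<bullet> n = k" "e \<bullet> e = 1" "n \<bullet> n = 1"
      using e(1,2) assms(3) by (simp_all add: unit_normal_def norm_eq_1 inner_commute)
    ultimately have "(N 0 - n) \<bullet> (N 0 - n) = 0"
      using e(2) k2 by (simp add: power2_eq_square)
    then show ?thesis
      by simp
  qed
  have deriv: "((\<lambda>t. fderiv X (u + t *\<^sub>R a) b) has_vector_derivative
          fderiv (\<lambda>x. fderiv X x b) u a) (at 0)" for b
    using assms(1,2) smooth_on_has_derivative[OF smooth_on_fderiv]
    unfolding local_parametrization_def by (intro has_vector_derivative_along_line) blast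
  have "bounded_bilinear cross3"
    using bilinear_cross by (simp add: bilinear_conv_bounded_bilinear)
  then have "w differentiable (at 0)"
    unfolding w_def \<nu>_def
    by (rule differentiableI_vector[OF bounded_bilinear.has_vector_derivative[OF _ deriv deriv]])
  moreover have w0: "w 0 \<noteq> 0"
    using \<nu>_nz[OF assms(2)] by (simp add: w_def)
  ultimately have "N differentiable (at 0)"
    unfolding N_def
    by (intro differentiable_scaleR differentiable_mult differentiable_inverse
        differentiable_compose[OF differentiable_norm_at]) auto
  then obtain N' where N': "(N has_vector_derivative N') (at 0)"
    using vector_derivative_works by blast
  have "((\<lambda>t. u + t *\<^sub>R a) \<longlongrightarrow> u + 0 *\<^sub>R a) (nhds 0)"
    by (intro tendsto_intros filterlim_ident)
  then have ev: "\<forall>\<^sub>F t in nhds 0. u + t *\<^sub>R a \<in> U"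
    using assms(1,2) by (intro topological_tendstoD) (auto simp: local_parametrization_def)
  have "\<bar>k\<bar> = 1"
    using k2 by (simp add: abs_square_eq_1)
  then have "unit_normal X (u + t *\<^sub>R a) (N t)" if "u + t *\<^sub>R a \<in> U" for t
    using \<nu>_nz[OF that] \<nu>_orth[OF that] 
    by (simp add: unit_normal_def N_def w_def abs_mult)
  then have "\<forall>\<^sub>F t in nhds 0. u + t *\<^sub>R a \<in> U \<and> unit_normal X (u + t *\<^sub>R a) (N t)"
    using ev by (auto elim: eventually_mono)
  with N0 N' show ?thesis
    by (rule that)
qed

text \<open>The range of the differential lies in the plane orthogonal to \<open>n\<close>, and both
  have dimension two.\<close>

lemma unit_normal_tangent:
  assumes "local_parametrization S U X" "u \<in> U" "unit_normal X u n" "n \<bullet> v = 0"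
  obtains a where "fderiv X u a = v"
proof -
  note L = local_parametrization_linear[OF assms(1,2)]
  have "n \<noteq> 0"
    using assms(3) by (auto simp: unit_normal_def)
  have "range (fderiv X u) = {x. n \<bullet> x = 0}"
  proof (rule subspace_dim_equal)
    show "subspace (range (fderiv X u))"
      using L(3) by (simp add: linear_subspace_image)
    show "subspace {x. n \<bullet> x = 0}"
      by (rule subspace_hyperplane)
    show "range (fderiv X u) \<subseteq> {x. n \<bullet> x = 0}"
      using assms(3) by (auto simp: unit_normal_def)
    have "dim (range (fderiv X u)) = dim (UNIV :: (real^2) set)"
      by (rule dim_image_eq) (use L in \<open>auto simp: inj_on_subset\<close>)
    then show "dim {x. n \<bullet> x = 0} \<le> dim (range (fderiv X u))"
      using \<open>n \<noteq> 0\<close> by (simp add: dim_hyperplane)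
  qed
  then have "v \<in> range (fderiv X u)"
    using assms(4) by simp
  then show ?thesis
    using that by blast
qed

section \<open>Tangent balls of radius less than one\<close>

lemma eventually_greater_at_right:
  fixes f :: "real \<Rightarrow> real"
  assumes "(f has_real_derivative l) (at 0)" "l > 0" "f 0 \<ge> g"
  shows "\<forall>\<^sub>F h in at_right 0. f h > g"
proof -
  obtain d where "d > 0" "\<forall>h>0. h < d \<longrightarrow> f 0 < f (0 + h)"
    using DERIV_pos_inc_right[OF assms(1,2)] by blast
  then show ?thesis
    using assms(3) unfolding eventually_at_right_field
    by (intro exI[of _ d]) (auto intro: le_less_trans)
qed

lemma has_real_derivative_eventually_const:
  fixes f :: "real \<Rightarrow> real"
  assumes "(f has_real_derivative D) (at x)" "\<forall>\<^sub>F t in nhds x. f t = k"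
  shows "D = 0"
proof -
  have "((\<lambda>_. k) has_real_derivative D) (at x)"
    using assms(1) DERIV_cong_ev[OF refl assms(2) refl] by blast
  then show ?thesis
    using DERIV_const DERIV_unique by blast
qed

text \<open>The displacement is in the direction of the tangential part \<open>v\<close> of \<open>p - c\<close>, where the
  curvature bound makes the derivative at least \<open>2 (1 - r) |v| > 0\<close>.\<close>

lemma surface_normal_variation:
  assumes K: "normal_curvatures_bounded_by S 1"
    and r: "0 < r" "r < 1"
    and p: "surface_normal S p n"
    and v: "p - c = v + h *\<^sub>R n" "n \<bullet> v = 0" "v \<noteq> 0"
  shows "\<exists>q m. surface_normal S q m
    \<and> (norm (q - c))\<^sup>2 - 2 * r * \<bar>m \<bullet> (q - c)\<bar> > (norm (p - c))\<^sup>2 - 2 * r * \<bar>n \<bullet> (p - c)\<bar>"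
    (is "\<exists>q m. _ \<and> ?G q m > ?G p n")
proof -
  obtain U X u where X: "local_parametrization S U X" "u \<in> U" "X u = p" "unit_normal X u n"
    using p unfolding surface_normal_def by blast
  obtain a where a: "fderiv X u a = sgn v"
    using unit_normal_tangent[OF X(1,2,4), of "sgn v"] v(2) by (auto simp: sgn_div_norm)
  obtain N N' where N: "N 0 = n" "(N has_vector_derivative N') (at 0)"
    "\<forall>\<^sub>F t in nhds 0. u + t *\<^sub>R a \<in> U \<and> unit_normal X (u + t *\<^sub>R a) (N t)"
    using differentiable_unit_normal[OF X(1,2,4)] by blast
  define f where "f = (\<lambda>t. X (u + t *\<^sub>R a))"
  define g where "g = (\<lambda>t. fderiv X (u + t *\<^sub>R a) a)"
  define w where "w = fderiv (\<lambda>x. fderiv X x a) u a"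
  have f0: "f 0 = p" and g0: "g 0 = sgn v"
    by (simp_all add: f_def g_def X(3) a)
  have f: "(f has_vector_derivative sgn v) (at 0)"
    unfolding f_def a[symmetric]
    by (rule has_vector_derivative_along_line[OF local_parametrization_linear(1)[OF X(1,2)]])
  have sm: "smooth_on X U"
    using X(1) by (simp add: local_parametrization_def)
  have g: "(g has_vector_derivative w) (at 0)"
    unfolding g_def w_def
    by (rule has_vector_derivative_along_line[OF smooth_on_has_derivative[OF smooth_on_fderiv[OF sm] X(2)]])
  have normal: "norm (N t) = 1" "N t \<bullet> g t = 0" if "unit_normal X (u + t *\<^sub>R a) (N t)" for t
    using that by (auto simp: unit_normal_def g_def)
  have evn: "\<forall>\<^sub>F t in nhds 0. unit_normal X (u + t *\<^sub>R a) (N t)"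
    using N(3) by (rule eventually_mono) simp
  \<comment> \<open>Differentiating \<open>N t \<bullet> N t = 1\<close> shows that
    \<open>N'\<close> is tangential. Differentiating \<open>N t \<bullet> g t = 0\<close> gives
    \<open>N' \<bullet> sgn v = - (n \<bullet> w)\<close>, and \<open>n \<bullet> w\<close> is the
    second fundamental form in the unit direction \<open>sgn v\<close>.\<close>
  have "((\<lambda>t. N t \<bullet> N t) has_real_derivative (n \<bullet> N' + N' \<bullet> n)) (at 0)"
    using bounded_bilinear.has_vector_derivative[OF bounded_bilinear_inner N(2) N(2)] N(1)
    by (simp add: has_real_derivative_iff_has_vector_derivative)
  moreover have "\<forall>\<^sub>F t in nhds 0. N t \<bullet> N t = 1"
    using evn by eventually_elim (simp add: normal norm_eq_1[symmetric])
  ultimately have "n \<bullet> N' + N' \<bullet> n = 0"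
    by (rule has_real_derivative_eventually_const)
  then have N'n: "N' \<bullet> n = 0"
    by (simp add: inner_commute)
  have "((\<lambda>t. N t \<bullet> g t) has_real_derivative (n \<bullet> w + N' \<bullet> sgn v)) (at 0)"
    using bounded_bilinear.has_vector_derivative[OF bounded_bilinear_inner N(2) g] N(1) g0
    by (simp add: has_real_derivative_iff_has_vector_derivative)
  moreover have "\<forall>\<^sub>F t in nhds 0. N t \<bullet> g t = 0"
    using evn by eventually_elim (simp add: normal)
  ultimately have "n \<bullet> w + N' \<bullet> sgn v = 0"
    by (rule has_real_derivative_eventually_const)
  moreover have "\<bar>n \<bullet> w\<bar> \<le> 1"
    using K X a v(3) unfolding normal_curvatures_bounded_by_def second_fundamental_form_def w_def
    by (metis norm_sgn)
  ultimately have N'v: "\<bar>N' \<bullet> sgn v\<bar> \<le> 1"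
    by linarith
  \<comment> \<open>The absolute value is replaced by a sign \<open>\<sigma>\<close>, which makes
    the function differentiable. The quantity to be increased is the smaller of
    \<open>\<phi> 1\<close> and \<open>\<phi> (-1)\<close>, so both have to exceed the initial
    value.\<close>
  define \<phi> where "\<phi> = (\<lambda>\<sigma> t. (f t - c) \<bullet> (f t - c) - 2 * r * \<sigma> * (N t \<bullet> (f t - c)))"
  have \<phi>0: "\<phi> \<sigma> 0 \<ge> ?G p n" if "\<bar>\<sigma>\<bar> = 1" for \<sigma>
  proof -
    have "\<sigma> * (n \<bullet> (p - c)) \<le> \<bar>n \<bullet> (p - c)\<bar>"
      using that by (metis abs_ge_self abs_mult mult_1)
    then have "r * (\<sigma> * (n \<bullet> (p - c))) \<le> r * \<bar>n \<bullet> (p - c)\<bar>"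
      using r by (intro mult_left_mono) auto
    then show ?thesis
      by (simp add: \<phi>_def f0 N(1) power2_norm_eq_inner mult.assoc)
  qed
  have ev: "\<forall>\<^sub>F t in at_right 0. \<phi> \<sigma> t > ?G p n" if \<sigma>: "\<bar>\<sigma>\<bar> = 1" for \<sigma>
  proof (rule eventually_greater_at_right)
    show "\<phi> \<sigma> 0 \<ge> ?G p n"
      by (rule \<phi>0[OF \<sigma>])
    have fc: "((\<lambda>t. f t - c) has_vector_derivative sgn v) (at 0)"
      using f by (auto intro!: derivative_eq_intros)
    have 1: "((\<lambda>t. (f t - c) \<bullet> (f t - c)) has_real_derivative
            ((p - c) \<bullet> sgn v + sgn v \<bullet> (p - c))) (at 0)"
      using bounded_bilinear.has_vector_derivative[OF bounded_bilinear_inner fc fc]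
      by (simp add: has_real_derivative_iff_has_vector_derivative f0)
    have 2: "((\<lambda>t. N t \<bullet> (f t - c)) has_real_derivative
            (n \<bullet> sgn v + N' \<bullet> (p - c))) (at 0)"
      using bounded_bilinear.has_vector_derivative[OF bounded_bilinear_inner N(2) fc]
      by (simp add: has_real_derivative_iff_has_vector_derivative f0 N(1))
    show "(\<phi> \<sigma> has_real_derivative (((p - c) \<bullet> sgn v + sgn v \<bullet> (p - c))
            - 2 * r * \<sigma> * (n \<bullet> sgn v + N' \<bullet> (p - c)))) (at 0)"
      unfolding \<phi>_def by (intro DERIV_diff 1 DERIV_cmult 2)
    have vv: "v = norm v *\<^sub>R sgn v"
      using v(3) by (simp add: sgn_div_norm)
    have nv: "n \<bullet> sgn v = 0"
      using v(2) by (simp add: sgn_div_norm)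
    have ss: "sgn v \<bullet> sgn v = 1"
      using v(3) by (simp add: norm_eq_1[symmetric] norm_sgn)
    \<comment> \<open>Both \<open>sgn v\<close> and \<open>N'\<close> are orthogonal to
      \<open>n\<close>, so only the tangential part of \<open>p - c\<close> enters, and the
      derivative is \<open>2 * norm v * (1 - r * (\<sigma> * (N' \<bullet> sgn v)))\<close>.\<close>
    have "(p - c) \<bullet> sgn v = norm v"
      unfolding v(1) by (subst vv) (simp add: inner_add_left ss nv)
    moreover have "N' \<bullet> (p - c) = norm v * (N' \<bullet> sgn v)"
      unfolding v(1) by (subst vv) (simp add: inner_add_right N'n)
    moreover have "r * (\<sigma> * (N' \<bullet> sgn v)) < 1"
    proof -
      have "\<bar>\<sigma> * (N' \<bullet> sgn v)\<bar> \<le> 1"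
        using \<sigma> N'v by (simp add: abs_mult)
      then have "r * (\<sigma> * (N' \<bullet> sgn v)) \<le> r * 1"
        using r by (intro mult_left_mono) auto
      also have "\<dots> < 1"
        using r by simp
      finally show ?thesis .
    qed
    then have "norm v * (1 - r * (\<sigma> * (N' \<bullet> sgn v))) > 0"
      using v(3) by simp
    ultimately show "(p - c) \<bullet> sgn v + sgn v \<bullet> (p - c)
            - 2 * r * \<sigma> * (n \<bullet> sgn v + N' \<bullet> (p - c)) > 0"
      by (simp add: nv inner_commute[of "sgn v"] algebra_simps)
  qed
  have "\<forall>\<^sub>F t in at_right 0. u + t *\<^sub>R a \<in> U \<and> unit_normal X (u + t *\<^sub>R a) (N t)"
    unfolding eventually_at_filter using N(3) by (rule eventually_mono) simp
  then have "\<forall>\<^sub>F t in at_right 0. surface_normal S (f t) (N t) \<and> ?G (f t) (N t) > ?G p n"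
    using ev[of 1, simplified] ev[of "-1", simplified]
  proof eventually_elim
    case (elim t)
    have "?G (f t) (N t) = min (\<phi> 1 t) (\<phi> (-1) t)"
      using r by (auto simp: \<phi>_def power2_norm_eq_inner abs_if min_def mult_le_0_iff zero_le_mult_iff)
    then show ?case
      using elim X(1) unfolding surface_normal_def f_def by auto
  qed
  then show ?thesis
    using eventually_happens'[OF trivial_limit_at_right_real] by blast
qed

text \<open>With the centre \<open>c\<close> as origin the conclusion says that the centre \<open>p - r n\<close> of the ball of
  radius \<open>r\<close> tangent to the surface at \<open>p\<close>, on the side of \<open>c\<close>, has distance at most \<open>r\<close>
  from \<open>c\<close>.\<close>

lemma tangent_ball_centre_bound:
  assumes S: "compact S" "smooth_embedded_surface S" "normal_curvatures_bounded_by S 1"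
    and r: "0 < r" "r < 1" and sub: "S \<subseteq> cball c (2 * r)"
    and p: "surface_normal S p n"
  shows "(norm (p - c))\<^sup>2 \<le> 2 * r * \<bar>n \<bullet> (p - c)\<bar>"
proof -
  define G where "G = (\<lambda>z. (norm (fst z - c))\<^sup>2 - 2 * r * \<bar>snd z \<bullet> (fst z - c)\<bar>)"
  have "continuous_on {(p, n). surface_normal S p n} G"
    unfolding G_def by (intro continuous_intros)
  then obtain q m where qm: "surface_normal S q m"
    and max: "\<And>q' m'. surface_normal S q' m' \<Longrightarrow> G (q', m') \<le> G (q, m)"
    using continuous_attains_sup[OF compact_surface_normals[OF S(1,2)]] p by fast
  define h where "h = m \<bullet> (q - c)"
  define v where "v = (q - c) - h *\<^sub>R m"
  have "m \<bullet> m = 1"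
    using surface_normal_norm[OF qm] by (simp add: norm_eq_1)
  then have "m \<bullet> v = 0"
    by (simp add: v_def h_def inner_diff_right)
  \<comment> \<open>Once the tangential part vanishes at the maximum, \<open>G (q, m)\<close> equals
    \<open>\<bar>h\<bar> * (\<bar>h\<bar> - 2 * r)\<close>, and \<open>\<bar>h\<bar>\<close> is the
    distance of \<open>q\<close> from \<open>c\<close>.\<close>
  have "v = 0"
  proof (rule ccontr)
    assume "v \<noteq> 0"
    then obtain q' m' where "surface_normal S q' m'" "G (q', m') > G (q, m)"
      using surface_normal_variation[OF S(3) r qm _ \<open>m \<bullet> v = 0\<close>, of c h]
      by (auto simp: v_def G_def)
    then show False
      using max by fastforce
  qed
  then have qc: "norm (q - c) = \<bar>h\<bar>"
    using surface_normal_norm[OF qm] by (simp add: v_def)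
  have "q \<in> S"
    using qm by (rule surface_normal_in)
  then have "\<bar>h\<bar> \<le> 2 * r"
    using sub by (auto simp: dist_norm norm_minus_commute simp flip: qc)
  then have "\<bar>h\<bar> * \<bar>h\<bar> \<le> 2 * r * \<bar>h\<bar>"
    by (intro mult_right_mono) auto
  then have "G (q, m) \<le> 0"
    by (simp add: G_def qc flip: h_def) (simp add: power2_eq_square)
  then show ?thesis
    using max[OF p] by (simp add: G_def)
qed

text \<open>If the inner product vanished, the bound would force \<open>p = c\<close>. Shifting the
  centre slightly in a tangent direction then contradicts the same bound for a slightly larger
  \<open>r\<close>.\<close>

lemma surface_normal_transversal:
  assumes S: "compact S" "smooth_embedded_surface S" "normal_curvatures_bounded_by S 1"
    and r: "0 < r" "r < 1" and sub: "S \<subseteq> cball c (2 * r)"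
    and p: "surface_normal S p n"
  shows "n \<bullet> (p - c) \<noteq> 0"
proof
  assume 0: "n \<bullet> (p - c) = 0"
  have "(norm (p - c))\<^sup>2 \<le> 2 * r * \<bar>n \<bullet> (p - c)\<bar>"
    using assms by (rule tangent_ball_centre_bound)
  then have pc: "p = c"
    using 0 by simp
  obtain U X u where X: "local_parametrization S U X" "u \<in> U" "X u = p" "unit_normal X u n"
    using p unfolding surface_normal_def by blast
  define v where "v = fderiv X u (axis 1 1)"
  have "v \<noteq> 0"
  proof
    assume "v = 0"
    then have "axis 1 1 = (0 :: real^2)"
      using local_parametrization_linear(3,4)[OF X(1,2)] linear_injective_0 unfolding v_def by blast
    then show False
      by (simp add: axis_eq_0_iff)
  qed
  \<comment> \<open>With \<open>r + s\<close> still below 1, the ball of radius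
    \<open>2 * (r + s)\<close> absorbs a shift of the centre by \<open>2 * s\<close>. Since
    \<open>p - c'\<close> is tangent, the bound would give \<open>p = c'\<close>.\<close>
  define s where "s = (1 - r) / 2"
  have s: "s > 0" "r + s < 1"
    using r by (auto simp: s_def field_simps)
  define c' where "c' = c + (2 * s) *\<^sub>R sgn v"
  have nv: "n \<bullet> sgn v = 0"
    using X(4) by (simp add: unit_normal_def v_def sgn_div_norm)
  have "dist c c' = 2 * s"
    using \<open>v \<noteq> 0\<close> r by (simp add: c'_def s_def dist_norm norm_sgn)
  have "S \<subseteq> cball c' (2 * (r + s))"
  proof
    fix x assume "x \<in> S"
    then have "dist c x \<le> 2 * r"
      using sub by auto
    then show "x \<in> cball c' (2 * (r + s))"
      using \<open>dist c c' = 2 * s\<close> dist_triangle3[of c' x c] by simp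
  qed
  then have "(norm (p - c'))\<^sup>2 \<le> 2 * (r + s) * \<bar>n \<bullet> (p - c')\<bar>"
    using s r by (intro tangent_ball_centre_bound[OF S _ _ _ p]) auto
  also have "n \<bullet> (p - c') = 0"
    by (simp add: pc c'_def nv)
  finally show False
    using \<open>v \<noteq> 0\<close> r by (simp add: pc c'_def norm_sgn s_def)
qed

section \<open>Star-shapedness\<close>

text \<open>Two points of \<open>S\<close> on one line through \<open>c\<close> differ by a multiple
  of \<open>q - c\<close>. Near \<open>p\<close> this has a definite normal component, whereas
  secants of \<open>S\<close> are almost orthogonal to \<open>n\<close>.\<close>

lemma radial_injective:
  assumes "surface_normal S p n" "n \<bullet> (p - c) \<noteq> 0"
  obtains d where "d > 0" "\<And>q t. \<lbrakk>q \<in> S; dist q p < d; c + t *\<^sub>R (q - c) \<in> S;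
      dist (c + t *\<^sub>R (q - c)) p < d\<rbrakk> \<Longrightarrow> t = 1"
proof -
  obtain U X u where X: "local_parametrization S U X" "u \<in> U" "X u = p" "unit_normal X u n"
    using assms(1) unfolding surface_normal_def by blast
  define A where "A = \<bar>n \<bullet> (p - c)\<bar>"
  \<comment> \<open>For \<open>q\<close> within distance 1 of \<open>p\<close> this makes
    \<open>e * norm (q - c)\<close> at most \<open>A/2\<close>; within distance \<open>A/2\<close>
    of \<open>p\<close>, \<open>\<bar>n \<bullet> (q - c)\<bar>\<close> exceeds
    \<open>A/2\<close>.\<close>
  define e where "e = A / (2 * (norm (p - c) + 1))"
  have "A > 0"
    using assms(2) by (simp add: A_def)
  have "norm (p - c) + 1 > 0"
    using norm_ge_zero[of "p - c"] by linarith
  then have e: "e > 0" "e * (norm (p - c) + 1) = A / 2"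
    using \<open>A > 0\<close> by (auto simp: e_def field_simps)
  obtain d where d: "d > 0" "\<And>q q'. \<lbrakk>q \<in> S; q' \<in> S; dist q (X u) < d; dist q' (X u) < d\<rbrakk>
      \<Longrightarrow> \<bar>n \<bullet> (q' - q)\<bar> \<le> e * norm (q' - q)"
    using unit_normal_secant_bound[OF X(1,2,4) e(1)] by blast
  have "t = 1" if q: "q \<in> S" "dist q p < min d (min 1 (A/2))" "c + t *\<^sub>R (q - c) \<in> S"
      "dist (c + t *\<^sub>R (q - c)) p < min d (min 1 (A/2))" for q t
  proof (rule ccontr)
    assume "t \<noteq> 1"
    have "c + t *\<^sub>R (q - c) - q = (t - 1) *\<^sub>R (q - c)"
      by (simp add: algebra_simps)
    then have "\<bar>n \<bullet> ((t - 1) *\<^sub>R (q - c))\<bar> \<le> e * norm ((t - 1) *\<^sub>R (q - c))"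
      using d(2)[OF q(1,3)] q X(3) by simp
    then have "\<bar>t - 1\<bar> * \<bar>n \<bullet> (q - c)\<bar> \<le> \<bar>t - 1\<bar> * (e * norm (q - c))"
      by (simp add: abs_mult mult_ac)
    then have "\<bar>n \<bullet> (q - c)\<bar> \<le> e * norm (q - c)"
      using \<open>t \<noteq> 1\<close> by simp
    also have "\<dots> \<le> e * (norm (p - c) + 1)"
      using norm_triangle_ineq[of "q - p" "p - c"] q(2) e(1)
      by (intro mult_left_mono) (auto simp: dist_norm)
    finally have "\<bar>n \<bullet> (q - c)\<bar> \<le> A / 2"
      using e(2) by simp
    moreover have "n \<bullet> (p - c) = n \<bullet> (q - c) - n \<bullet> (q - p)"
      by (simp add: inner_diff_right)
    moreover have "\<bar>n \<bullet> (q - p)\<bar> \<le> norm (q - p)"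
      using Cauchy_Schwarz_ineq2[of n "q - p"] surface_normal_norm[OF assms(1)] by simp
    moreover have "norm (q - p) < A / 2"
      using q(2) by (simp add: dist_norm)
    ultimately show False
      unfolding A_def by linarith
  qed
  then show ?thesis
    using d(1) \<open>A > 0\<close> by (intro that[of "min d (min 1 (A/2))"]) auto
qed

text \<open>The tangent plane and \<open>p - c\<close> span the space, so the map sending
  \<open>(s, w)\<close> to \<open>c + s *\<^sub>R (X w - c)\<close> has a surjective differential at
  \<open>(1, u)\<close>. By the open mapping property its image is a neighbourhood of
  \<open>p\<close>.\<close>

lemma radial_open:
  assumes "surface_normal S p n" "n \<bullet> (p - c) \<noteq> 0" "e > 0"
  obtains d where "d > 0" "\<And>z. dist z p < d \<Longrightarrow> \<exists>t. \<bar>t - 1\<bar> < e \<and> c + t *\<^sub>R (z - c) \<in> S"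
proof -
  obtain U X u where X: "local_parametrization S U X" "u \<in> U" "X u = p" "unit_normal X u n"
    using assms(1) unfolding surface_normal_def by blast
  note L = local_parametrization_linear[OF X(1,2)]
  interpret D: bounded_linear "fderiv X u" by (rule L(2))
  have "open U"
    using X(1) by (simp add: local_parametrization_def)
  \<comment> \<open>The factor \<open>s\<close> will stay above \<open>1/2\<close>, so its inverse
    differs from 1 by less than \<open>2 * e'\<close>, hence by less than \<open>e\<close>.\<close>
  define e' where "e' = min (1/2) (e/2)"
  have e': "e' > 0" "e' \<le> 1/2" "e' \<le> e/2"
    using assms(3) by (auto simp: e'_def)
  define f where "f = (\<lambda>z. c + fst z *\<^sub>R (X (snd z) - c))"
  define f' where "f' = (\<lambda>h. 1 *\<^sub>R fderiv X u (snd h) + fst h *\<^sub>R (p - c))"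
  have "(X has_derivative fderiv X u) (at (snd (1::real, u)))"
    using L(1) by simp
  then have "((\<lambda>z. X (snd z)) has_derivative (\<lambda>h. fderiv X u (snd h))) (at (1::real, u))"
    by (rule has_derivative_compose[OF has_derivative_snd[OF has_derivative_ident]])
  then have "((\<lambda>z. fst z *\<^sub>R (X (snd z) - c)) has_derivative f') (at (1::real, u))"
    using has_derivative_scaleR[OF has_derivative_fst[OF has_derivative_ident]
        has_derivative_diff[OF _ has_derivative_const], of "\<lambda>z. X (snd z)" _ "(1::real, u)" UNIV c] X(3)
    by (simp add: f'_def)
  then have der: "(f has_derivative f') (at (1::real, u))"
    unfolding f_def using has_derivative_add[OF has_derivative_const] by fastforce
  have cont: "continuous_on (UNIV \<times> U) f"
  proof -
    have "continuous_on U X"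
      using X(1) by (auto simp: local_parametrization_def intro: smooth_on_imp_continuous_on)
    then have "continuous_on (UNIV \<times> U) (\<lambda>z. X (snd z))"
      by (rule continuous_on_compose2) (auto intro: continuous_intros)
    then show ?thesis
      unfolding f_def by (intro continuous_intros)
  qed
  obtain l where l: "linear l" "l \<circ> fderiv X u = id"
    using linear_injective_left_inverse[OF L(3,4)] by blast
  \<comment> \<open>\<open>g\<close> is a right inverse of \<open>f'\<close>: \<open>s\<close> reads
    off the coefficient of \<open>p - c\<close>, and \<open>l\<close> inverts the differential on
    the tangential remainder.\<close>
  define s where "s = (\<lambda>z. (n \<bullet> z) / (n \<bullet> (p - c)))"
  define g where "g = (\<lambda>z. (s z, l (z - s z *\<^sub>R (p - c))))"
  have lin_s: "bounded_linear s"
    unfolding s_def by (rule bounded_linear_compose[OF bounded_linear_divide bounded_linear_inner_right])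
  have "bounded_linear l"
    using l(1) by (simp add: linear_conv_bounded_linear)
  then have "bounded_linear (\<lambda>z. l (z - s z *\<^sub>R (p - c)))"
    by (rule bounded_linear_compose[OF _ bounded_linear_sub[OF bounded_linear_ident
          bounded_linear_scaleR_const[OF lin_s]]])
  then have "bounded_linear g"
    unfolding g_def by (rule bounded_linear_Pair[OF lin_s])
  moreover have "f' \<circ> g = id"
  proof
    fix z
    have "n \<bullet> (z - s z *\<^sub>R (p - c)) = 0"
      using assms(2) by (simp add: s_def inner_diff_right)
    then obtain a where a: "fderiv X u a = z - s z *\<^sub>R (p - c)"
      using unit_normal_tangent[OF X(1,2,4)] by blast
    have "l (fderiv X u a) = a"
      using l(2) by (metis comp_apply id_apply)
    then have "fderiv X u (l (z - s z *\<^sub>R (p - c))) = z - s z *\<^sub>R (p - c)"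
      using a by simp
    then show "(f' \<circ> g) z = id z"
      by (simp add: f'_def g_def)
  qed
  moreover have "(1, u) \<in> interior (ball 1 e' \<times> U)"
    using e'(1) X(2) \<open>open U\<close> by (simp add: interior_Times interior_open)
  ultimately have "f (1, u) \<in> interior (f ` (ball 1 e' \<times> U))"
    using X(2) \<open>open U\<close> cont der
    by (intro sussmann_open_mapping[of "UNIV \<times> U" f "(1, u)" f' g]) (auto intro: open_Times)
  then obtain d where d: "d > 0" "ball p d \<subseteq> f ` (ball 1 e' \<times> U)"
    unfolding mem_interior by (auto simp: f_def X(3))
  have "\<exists>t. \<bar>t - 1\<bar> < e \<and> c + t *\<^sub>R (z - c) \<in> S" if z: "dist z p < d" for z
  proof -
    obtain s w where sw: "\<bar>s - 1\<bar> < e'" "w \<in> U" "z = c + s *\<^sub>R (X w - c)"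
      using z d(2) unfolding f_def by (force simp: dist_commute dist_real_def)
    have "s > 1/2"
      using sw(1) e'(2) by linarith
    then have "1 / s - 1 = (1 - s) / s"
      by (simp add: field_simps)
    moreover have "\<bar>(1 - s) / s\<bar> < e"
    proof -
      have "\<bar>1 - s\<bar> < e * (1 / 2)"
        using sw(1) e'(3) by linarith
      also have "\<dots> \<le> e * s"
        using \<open>s > 1/2\<close> assms(3) by (intro mult_left_mono) auto
      finally show ?thesis
        using \<open>s > 1/2\<close> by (simp add: abs_divide divide_less_eq)
    qed
    ultimately have "\<bar>1 / s - 1\<bar> < e"
      by simp
    moreover have "c + (1 / s) *\<^sub>R (z - c) = X w"
      using \<open>s > 1/2\<close> by (simp add: sw(3))
    ultimately show ?thesis
      using local_parametrization_in[OF X(1) sw(2)] by auto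
  qed
  then show ?thesis
    using d(1) that by blast
qed

text \<open>The set of points where a ray from \<open>c\<close> first hits the surface is open and closed in it.\<close>

lemma ray_meets_surface_once:
  assumes "compact S" "connected S"
    and tr: "\<And>p. p \<in> S \<Longrightarrow> \<exists>n. surface_normal S p n \<and> n \<bullet> (p - c) \<noteq> 0"
    and "p \<in> S" "c + t *\<^sub>R (p - c) \<in> S" "t > 0"
  shows "t = 1"
proof -
  have "c \<notin> S"
    using tr by force
  define F where "F = {p\<in>S. \<forall>t. 0 < t \<and> t < 1 \<longrightarrow> c + t *\<^sub>R (p - c) \<notin> S}"
  have "openin (top_of_set S) (S - F)"
    unfolding openin_contains_ball
  proof (intro conjI ballI)
    fix p assume "p \<in> S - F"
    then obtain t where t: "0 < t" "t < 1" "c + t *\<^sub>R (p - c) \<in> S"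
      by (auto simp: F_def)
    \<comment> \<open>A factor \<open>s\<close> within \<open>e\<close> of 1 satisfies
      \<open>0 < s * t < 1\<close>, so nearby rays still meet \<open>S\<close> before reaching
      \<open>q\<close>.\<close>
    define e where "e = min 1 (1 / t - 1)"
    have "e > 0"
      using t by (simp add: e_def)
    obtain d where d: "d > 0"
      "\<And>z. dist z (c + t *\<^sub>R (p - c)) < d \<Longrightarrow> \<exists>s. \<bar>s - 1\<bar> < e \<and> c + s *\<^sub>R (z - c) \<in> S"
      using radial_open[OF _ _ \<open>e > 0\<close>] tr[OF t(3)] by metis
    have "ball p d \<inter> S \<subseteq> S - F"
    proof
      fix q assume q: "q \<in> ball p d \<inter> S"
      have "dist (c + t *\<^sub>R (q - c)) (c + t *\<^sub>R (p - c)) = t * dist q p"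
        using t(1) by (simp add: dist_norm flip: scaleR_diff_right)
      also have "\<dots> \<le> 1 * dist q p"
        using t(2) by (intro mult_right_mono) auto
      finally obtain s where s: "\<bar>s - 1\<bar> < e" "c + s *\<^sub>R (c + t *\<^sub>R (q - c) - c) \<in> S"
        using d(2)[of "c + t *\<^sub>R (q - c)"] q by (auto simp: dist_commute)
      have "0 < s" "s < 1 / t"
        using s(1) by (auto simp: e_def)
      then have "0 < s * t" "s * t < 1"
        using t(1) by (auto simp: field_simps)
      then show "q \<in> S - F"
        using s(2) q by (auto simp: F_def)
    qed
    then show "\<exists>e>0. ball p e \<inter> S \<subseteq> S - F"
      using d(1) by blast
  qed auto
  moreover have "closedin (top_of_set S) (S - F)"
  proof -
    have "closed (S - F)"
      unfolding closed_sequential_limits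
    proof (intro allI impI, elim conjE)
      fix P p assume P: "\<forall>k. P k \<in> S - F" "P \<longlonglongrightarrow> p"
      then have "p \<in> S"
        using compact_imp_closed[OF assms(1)] closed_sequentially by blast
      have "\<forall>k. \<exists>t. 0 < t \<and> t < 1 \<and> c + t *\<^sub>R (P k - c) \<in> S"
        using P(1) by (auto simp: F_def)
      then obtain T where T: "\<And>k. 0 < T k" "\<And>k. T k < 1" "\<And>k. c + T k *\<^sub>R (P k - c) \<in> S"
        by metis
      have "T k \<in> {0..1}" for k
        using T(1,2)[of k] by simp
      then obtain t r where t: "t \<in> {0..1}" and r: "strict_mono r" "(T \<circ> r) \<longlonglongrightarrow> t"
        using compact_Icc[of 0 1, unfolded compact_def] by metis
      have Pr: "(P \<circ> r) \<longlonglongrightarrow> p"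
        using P(2) r(1) by (rule LIMSEQ_subseq_LIMSEQ)
      have lim: "(\<lambda>k. c + T (r k) *\<^sub>R (P (r k) - c)) \<longlonglongrightarrow> c + t *\<^sub>R (p - c)"
        using Pr r(2) by (intro tendsto_intros) (simp_all add: o_def)
      then have in_S: "c + t *\<^sub>R (p - c) \<in> S"
        by (rule closed_sequentially[OF compact_imp_closed[OF assms(1)] T(3)])
      then have "t \<noteq> 0"
        using \<open>c \<notin> S\<close> by auto
      \<comment> \<open>Earlier hits cannot merge with \<open>p\<close> in the limit: local radial
        injectivity would force \<open>T (r k) = 1\<close>.\<close>
      have "t \<noteq> 1"
      proof
        assume "t = 1"
        obtain n where n: "surface_normal S p n" "n \<bullet> (p - c) \<noteq> 0"
          using tr[OF \<open>p \<in> S\<close>] by blast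
        obtain d where d: "d > 0" "\<And>q t. \<lbrakk>q \<in> S; dist q p < d; c + t *\<^sub>R (q - c) \<in> S;
            dist (c + t *\<^sub>R (q - c)) p < d\<rbrakk> \<Longrightarrow> t = 1"
          using radial_injective[OF n] by blast
        have "\<forall>\<^sub>F k in sequentially. dist (P (r k)) p < d"
          using tendstoD[OF Pr d(1)] by (simp add: o_def)
        moreover have "\<forall>\<^sub>F k in sequentially. dist (c + T (r k) *\<^sub>R (P (r k) - c)) p < d"
          using tendstoD[OF lim d(1)] \<open>t = 1\<close> by simp
        ultimately have "\<forall>\<^sub>F k in sequentially. T (r k) = 1"
        proof eventually_elim
          case (elim k)
          then show ?case
            using d(2) P(1) T(3) by (meson DiffD1)
        qed
        then obtain k where "T (r k) = 1"
          using eventually_happens'[OF sequentially_bot] by blast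
        then show False
          using T(2)[of "r k"] by simp
      qed
      with \<open>t \<noteq> 0\<close> t have "0 < t" "t < 1"
        by auto
      with in_S show "p \<in> S - F"
        using \<open>p \<in> S\<close> by (auto simp: F_def)
    qed
    then show ?thesis
      by (simp add: closed_subset)
  qed
  ultimately have "S - F = {} \<or> S - F = S"
    using assms(2) unfolding connected_clopen by blast
  \<comment> \<open>A point of \<open>S\<close> nearest to \<open>c\<close> is a first hit.\<close>
  moreover have "S - F \<noteq> S"
  proof -
    obtain p where p: "p \<in> S" "\<And>q. q \<in> S \<Longrightarrow> dist c p \<le> dist c q"
      using distance_attains_inf[of S c] compact_imp_closed[OF assms(1)] assms(4) by blast
    have "p \<in> F"
      unfolding F_def
    proof (intro CollectI conjI p(1) allI impI notI)
      fix t assume t: "0 < t \<and> t < 1" "c + t *\<^sub>R (p - c) \<in> S"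
      have "dist c (c + t *\<^sub>R (p - c)) = t * dist c p"
        using t(1) by (simp add: dist_norm norm_minus_commute)
      also have "\<dots> < 1 * dist c p"
        using t(1) p(1) \<open>c \<notin> S\<close> by (intro mult_strict_right_mono) auto
      finally show False
        using p(2)[OF t(2)] by simp
    qed
    then show ?thesis
      using p(1) by blast
  qed
  ultimately have F: "S \<subseteq> F"
    by blast
  have "\<not> t < 1"
    using F assms(4-6) by (auto simp: F_def)
  moreover have "\<not> t > 1"
  proof
    assume "t > 1"
    have "c + t *\<^sub>R (p - c) \<in> F"
      using F assms(5) by blast
    moreover have "c + (1 / t) *\<^sub>R (c + t *\<^sub>R (p - c) - c) = p" "0 < 1 / t" "1 / t < 1"
      using \<open>t > 1\<close> by auto
    ultimately show False
      using assms(4) unfolding F_def by (metis (no_types, lifting) mem_Collect_eq)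
  qed
  ultimately show ?thesis
    by linarith
qed

lemma outside_if_ray_avoids:
  fixes S :: "'a::real_normed_vector set"
  assumes "z \<noteq> c" and avoid: "\<And>t. t \<ge> 1 \<Longrightarrow> c + t *\<^sub>R (z - c) \<notin> S"
  shows "z \<in> outside S"
proof -
  define R where "R = (\<lambda>t. c + t *\<^sub>R (z - c)) ` {1..}"
  have "connected R"
    unfolding R_def by (intro connected_continuous_image continuous_intros) auto
  moreover have "z \<in> R"
    unfolding R_def by (rule image_eqI[of _ _ 1]) auto
  moreover have "R \<subseteq> - S"
    using avoid by (auto simp: R_def)
  ultimately have sub: "R \<subseteq> connected_component_set (- S) z"
    by (intro connected_component_maximal)
  have "\<not> bounded R"
  proof
    assume "bounded R"
    then obtain B where B: "\<And>x. x \<in> R \<Longrightarrow> norm x \<le> B"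
      unfolding bounded_iff by blast
    define t where "t = max 1 ((B + norm c + 1) / norm (z - c))"
    have "norm (c + t *\<^sub>R (z - c)) \<le> B"
      by (rule B) (auto simp: R_def t_def)
    moreover have "norm (t *\<^sub>R (z - c)) \<le> norm (c + t *\<^sub>R (z - c)) + norm c"
      using norm_triangle_ineq4[of "c + t *\<^sub>R (z - c)" c] by simp
    moreover have "norm (t *\<^sub>R (z - c)) = t * norm (z - c)"
      by (simp add: t_def)
    moreover have "(B + norm c + 1) / norm (z - c) * norm (z - c) \<le> t * norm (z - c)"
      by (intro mult_right_mono) (auto simp: t_def)
    ultimately show False
      using assms(1) by simp
  qed
  then have "\<not> bounded (connected_component_set (- S) z)"
    using sub bounded_subset by blast
  moreover have "z \<notin> S"
    using avoid[of 1] by simp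
  ultimately show ?thesis
    by (simp add: outside_def)
qed

lemma connected_subset_inside:
  assumes "connected T" "T \<inter> S = {}" "x \<in> T" "x \<in> inside S"
  shows "T \<subseteq> inside S"
proof
  fix y assume "y \<in> T"
  then have "connected_component (- S) x y"
    using assms unfolding connected_component_def by blast
  then show "y \<in> inside S"
    using assms(4) by (rule inside_same_component)
qed

text \<open>Beyond \<open>p\<close> the ray runs off to infinity without meeting \<open>S\<close>
  again. Before \<open>p\<close> the segment back to \<open>c\<close> avoids \<open>S\<close>, so it
  remains to see that \<open>c\<close> is inside.\<close>

lemma inside_outside_of_star_shaped:
  fixes S :: "'a::real_normed_vector set"
  assumes "c \<notin> S" "inside S \<noteq> {}"
    and once: "\<And>p t. \<lbrakk>p \<in> S; c + t *\<^sub>R (p - c) \<in> S; t > 0\<rbrakk> \<Longrightarrow> t = 1"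
    and "p \<in> S"
  shows "t > 1 \<Longrightarrow> c + t *\<^sub>R (p - c) \<in> outside S"
    and "0 \<le> t \<Longrightarrow> t < 1 \<Longrightarrow> c + t *\<^sub>R (p - c) \<in> inside S"
proof -
  assume "t > 1"
  show "c + t *\<^sub>R (p - c) \<in> outside S"
  proof (rule outside_if_ray_avoids)
    show "c + t *\<^sub>R (p - c) \<noteq> c"
      using \<open>t > 1\<close> assms(1,4) by auto
    fix s :: real assume "s \<ge> 1"
    then have "s * t \<ge> 1 * t"
      using \<open>t > 1\<close> by (intro mult_right_mono) auto
    then have "s * t > 1"
      using \<open>t > 1\<close> by linarith
    then show "c + s *\<^sub>R (c + t *\<^sub>R (p - c) - c) \<notin> S"
      using once[OF assms(4), of "s * t"] by auto
  qed
next
  have segment: "closed_segment c (c + t *\<^sub>R (p - c)) \<inter> S = {}"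
    if "p \<in> S" "0 \<le> t" "t < 1" for p t
  proof -
    have avoid: "c + (s * t) *\<^sub>R (p - c) \<notin> S" if s: "0 \<le> s" "s \<le> 1" for s
    proof (cases "s * t = 0")
      case False
      have "s * t \<le> 1 * t"
        using s \<open>0 \<le> t\<close> by (intro mult_right_mono) auto
      moreover have "s * t > 0"
        using False s \<open>0 \<le> t\<close> by (simp add: less_le)
      ultimately show ?thesis
        using once[OF \<open>p \<in> S\<close>, of "s * t"] \<open>t < 1\<close> by auto
    qed (use assms(1) in auto)
    show ?thesis
    proof -
      have "closed_segment c (c + t *\<^sub>R (p - c)) = (\<lambda>s. c + (s * t) *\<^sub>R (p - c)) ` {0..1}"
        unfolding closed_segment_image_interval by (intro image_cong) (simp_all add: algebra_simps)
      then show ?thesis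
        using avoid by auto
    qed
  qed
  obtain z where z: "z \<in> inside S"
    using assms(2) by blast
  \<comment> \<open>The half-line from an inside point \<open>z\<close> away from \<open>c\<close>
    must hit \<open>S\<close>, as otherwise \<open>z\<close> would be outside. So \<open>z\<close>
    precedes a point of \<open>S\<close> on its ray and is joined to \<open>c\<close> off
    \<open>S\<close>.\<close>
  have "c \<in> inside S"
  proof (cases "z = c")
    case False
    have "z \<notin> outside S"
      using z inside_Int_outside by blast
    then obtain s where s: "s \<ge> 1" "c + s *\<^sub>R (z - c) \<in> S"
      using outside_if_ray_avoids[OF False] by blast
    have "z \<notin> S"
      using z inside_no_overlap by blast
    then have "s > 1"
      using s by (cases "s = 1") auto
    then have "z = c + (1 / s) *\<^sub>R (c + s *\<^sub>R (z - c) - c)" "0 \<le> 1 / s" "1 / s < 1"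
      by auto
    then have "closed_segment c z \<inter> S = {}"
      using segment[OF s(2), of "1 / s"] by metis
    then show ?thesis
      using connected_subset_inside[of "closed_segment c z" S z] z by auto
  qed (use z in simp)
  moreover assume "0 \<le> t" "t < 1"
  then have "closed_segment c (c + t *\<^sub>R (p - c)) \<inter> S = {}"
    by (rule segment[OF assms(4)])
  ultimately show "c + t *\<^sub>R (p - c) \<in> inside S"
    using connected_subset_inside[OF connected_segment, of c _ S c] by auto
qed

section \<open>Inscribed balls tangent at a farthest point\<close>

text \<open>Along each coordinate line through \<open>p\<close> the squared distance to
  \<open>x\<close> has a local minimum, so \<open>p - x\<close> is orthogonal to every tangent
  vector.\<close>

lemma nearest_point_normal:
  assumes S: "smooth_embedded_surface S"
    and p: "p \<in> S" "p \<noteq> x" and min: "\<And>q. q \<in> S \<Longrightarrow> norm (p - x) \<le> norm (q - x)"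
  shows "surface_normal S p (sgn (p - x))"
proof -
  obtain U X u where X: "local_parametrization S U X" "u \<in> U" "p = X u"
    using S p(1) unfolding smooth_embedded_surface_def by blast
  have "(p - x) \<bullet> fderiv X u a = 0" for a
  proof -
    define f where "f = (\<lambda>t. X (u + t *\<^sub>R a) - x)"
    have f0: "f 0 = p - x"
      by (simp add: f_def X(3))
    have "(f has_vector_derivative fderiv X u a - 0) (at 0)"
      unfolding f_def
      by (intro has_vector_derivative_diff has_vector_derivative_const
          has_vector_derivative_along_line[OF local_parametrization_linear(1)[OF X(1,2)]])
    then have f: "(f has_vector_derivative fderiv X u a) (at 0)"
      by simp
    have der: "((\<lambda>t. f t \<bullet> f t) has_real_derivative
        ((p - x) \<bullet> fderiv X u a + fderiv X u a \<bullet> (p - x))) (at 0)"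
      using bounded_bilinear.has_vector_derivative[OF bounded_bilinear_inner f f]
      by (simp add: has_real_derivative_iff_has_vector_derivative f0)
    have "((\<lambda>t. u + t *\<^sub>R a) \<longlongrightarrow> u + 0 *\<^sub>R a) (nhds 0)"
      by (intro tendsto_intros filterlim_ident)
    then have "\<forall>\<^sub>F t in nhds 0. u + t *\<^sub>R a \<in> U"
      using X(1,2) by (intro topological_tendstoD) (auto simp: local_parametrization_def)
    then obtain d where d: "d > 0" "\<And>t. dist t 0 < d \<Longrightarrow> u + t *\<^sub>R a \<in> U"
      unfolding eventually_nhds_metric by blast
    have "(p - x) \<bullet> fderiv X u a + fderiv X u a \<bullet> (p - x) = 0"
    proof (rule DERIV_local_min[OF der d(1)], intro allI impI)
      fix t :: real assume "\<bar>0 - t\<bar> < d"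
      then have "norm (f 0) \<le> norm (f t)"
        using min[OF local_parametrization_in[OF X(1) d(2)[of t]]] by (simp add: f0) (simp add: f_def)
      then show "f 0 \<bullet> f 0 \<le> f t \<bullet> f t"
        by (simp add: norm_le)
    qed
    then show ?thesis
      by (simp add: inner_commute)
  qed
  then have "unit_normal X u (sgn (p - x))"
    using p(2) by (simp add: unit_normal_def norm_sgn) (simp add: sgn_div_norm)
  then show ?thesis
    using X unfolding surface_normal_def by blast
qed

text \<open>The balls are tangent from the side of \<open>c\<close> at a point of \<open>S\<close>
  farthest from \<open>c\<close>. The gap \<open>r - T\<close> bounds the rate at which a
  penetration of \<open>S\<close> can grow with the radius.\<close>

lemma tangent_ball_disjoint:
  assumes S: "compact S" "smooth_embedded_surface S" "normal_curvatures_bounded_by S 1"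
    and conn: "connected S" "inside S \<noteq> {}"
    and r: "r < 1" and sub: "S \<subseteq> cball c (2 * r)"
    and u: "norm u = 1" "c + (2 * r) *\<^sub>R u \<in> S"
    and T: "0 < T" "T < r"
  shows "ball (c + (2 * r - T) *\<^sub>R u) T \<inter> S = {}" "c + (2 * r - T) *\<^sub>R u \<in> inside S"
proof -
  have "0 < r"
    using T by linarith
  have bound: "(norm (p - c))\<^sup>2 \<le> 2 * r * \<bar>n \<bullet> (p - c)\<bar>" if "surface_normal S p n" for p n
    using S \<open>0 < r\<close> r sub that by (rule tangent_ball_centre_bound)
  have tr: "n \<bullet> (p - c) \<noteq> 0" if "surface_normal S p n" for p n
    using S \<open>0 < r\<close> r sub that by (rule surface_normal_transversal)
  have tr': "\<exists>n. surface_normal S p n \<and> n \<bullet> (p - c) \<noteq> 0" if p: "p \<in> S" for p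
    using surface_normal_exists[OF S(2) p] tr by blast
  then have "c \<notin> S"
    by force
  have once: "t = 1" if "p \<in> S" "c + t *\<^sub>R (p - c) \<in> S" "t > 0" for p t
    using ray_meets_surface_once[OF S(1) conn(1) tr' that] .
  have outside: "c + t *\<^sub>R (p - c) \<in> outside S" if "p \<in> S" "t > 1" for p t
    using inside_outside_of_star_shaped(1)[OF \<open>c \<notin> S\<close> conn(2) _ that] once by blast
  have inside: "c + t *\<^sub>R (p - c) \<in> inside S" if "p \<in> S" "0 \<le> t" "t < 1" for p t
    using inside_outside_of_star_shaped(2)[OF \<open>c \<notin> S\<close> conn(2) _ that] once by blast
  have x_inside: "c + (2 * r - \<tau>) *\<^sub>R u \<in> inside S" if "0 < \<tau>" "\<tau> < r" for \<tau>
  proof -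
    have "c + ((2 * r - \<tau>) / (2 * r)) *\<^sub>R (c + (2 * r) *\<^sub>R u - c) \<in> inside S"
      using that \<open>0 < r\<close> by (intro inside u(2)) auto
    then show ?thesis
      using \<open>0 < r\<close> by simp
  qed
  define x where "x = (\<lambda>\<tau>. c + (2 * r - \<tau>) *\<^sub>R u)"
  \<comment> \<open>Let \<open>e\<close> be the defect \<open>\<tau> - dist (x \<tau>) S\<close>. The bound on the tangent ball centre at the nearest
     point gives \<open>e' \<le> e / (r - T)\<close>; with the weight \<open>exp (- C \<tau>)\<close> for the doubled rate \<open>C\<close>,
     Gronwall's argument turns into a contradiction at one maximum point.\<close>
  define C where "C = 2 / (r - T)"
  define H where "H = (\<lambda>z. (fst z - norm (snd z - x (fst z))) * exp (- (C * fst z)))"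
  have H_le: "H (T, q) \<le> 0" if "q \<in> S" for q
  proof (rule ccontr)
    assume "\<not> H (T, q) \<le> 0"
    have "compact ({0..T} \<times> S)"
      using S(1) by (intro compact_Times compact_Icc)
    moreover have "continuous_on ({0..T} \<times> S) H"
      unfolding H_def x_def by (intro continuous_intros)
    moreover have "{0..T} \<times> S \<noteq> {}"
      using T that by auto
    ultimately obtain z where z: "z \<in> {0..T} \<times> S" "\<forall>y\<in>{0..T} \<times> S. H y \<le> H z"
      using continuous_attains_sup by blast
    obtain \<tau> p where [simp]: "z = (\<tau>, p)"
      by (cases z)
    have \<tau>: "0 \<le> \<tau>" "\<tau> \<le> T" and p: "p \<in> S"
      using z(1) by auto
    have max: "H (\<tau>', p') \<le> H (\<tau>, p)" if "0 \<le> \<tau>'" "\<tau>' \<le> T" "p' \<in> S" for \<tau>' p'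
      using z(2) that by auto
    have "H (\<tau>, p) > 0"
      using max[of T q] \<open>\<not> H (T, q) \<le> 0\<close> T that by simp
    define d where "d = norm (p - x \<tau>)"
    define e where "e = \<tau> - d"
    have "e > 0"
      using \<open>H (\<tau>, p) > 0\<close> by (simp add: H_def e_def d_def zero_less_mult_iff)
    have "d \<ge> 0"
      by (simp add: d_def)
    have "\<tau> > 0"
      using \<open>e > 0\<close> \<open>d \<ge> 0\<close> by (simp add: e_def)
    have x: "x \<tau> \<in> inside S"
      using x_inside[of \<tau>] \<tau> \<open>\<tau> > 0\<close> T by (simp add: x_def)
    then have "x \<tau> \<notin> S"
      using inside_no_overlap by blast
    then have "p \<noteq> x \<tau>"
      using p by auto
    then have "d > 0"
      by (simp add: d_def)
    have nearest: "d \<le> norm (q - x \<tau>)" if "q \<in> S" for q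
      using max[OF \<tau> that] by (simp add: H_def d_def)
    define m where "m = sgn (p - x \<tau>)"
    have m: "surface_normal S p m"
      unfolding m_def using S(2) p \<open>p \<noteq> x \<tau>\<close> nearest
      by (intro nearest_point_normal) (auto simp: d_def)
    have dm: "p - x \<tau> = d *\<^sub>R m"
      using \<open>d > 0\<close> by (simp add: m_def d_def sgn_div_norm)
    \<comment> \<open>Fixes the sign of \<open>m\<close>, which removes the absolute value from the
      bound. The open ball of radius \<open>d\<close> about \<open>x \<tau>\<close> lies inside;
      were the product negative, it would contain a point of the ray from \<open>c\<close> beyond
      \<open>p\<close>, which is outside. The step \<open>h\<close> minimizes the distance to
      \<open>x \<tau>\<close> along that ray.\<close>
    have "(p - x \<tau>) \<bullet> (p - c) \<ge> 0"
    proof (rule ccontr)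
      define b where "b = (p - x \<tau>) \<bullet> (p - c)"
      define h where "h = - b / (norm (p - c))\<^sup>2"
      assume "\<not> (p - x \<tau>) \<bullet> (p - c) \<ge> 0"
      then have "b < 0"
        by (simp add: b_def)
      have "norm (p - c) > 0"
        using p \<open>c \<notin> S\<close> by auto
      then have "h > 0"
        using \<open>b < 0\<close> unfolding h_def by (intro divide_pos_pos) auto
      have "(norm (p - x \<tau> + h *\<^sub>R (p - c)))\<^sup>2 = d\<^sup>2 + 2 * h * b + h * (h * (norm (p - c))\<^sup>2)"
        by (simp add: power2_norm_eq_inner d_def b_def inner_add_left inner_add_right inner_commute)
      also have "h * (norm (p - c))\<^sup>2 = - b"
        using \<open>norm (p - c) > 0\<close> by (simp add: h_def)
      also have "d\<^sup>2 + 2 * h * b + h * - b < d\<^sup>2"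
        using mult_pos_neg[OF \<open>h > 0\<close> \<open>b < 0\<close>] by (simp add: mult.commute)
      finally have "norm (p - x \<tau> + h *\<^sub>R (p - c)) < d"
        using \<open>d \<ge> 0\<close> by (rule power2_less_imp_less)
      moreover have "c + (1 + h) *\<^sub>R (p - c) - x \<tau> = p - x \<tau> + h *\<^sub>R (p - c)"
        by (simp add: algebra_simps)
      ultimately have "c + (1 + h) *\<^sub>R (p - c) \<in> ball (x \<tau>) d"
        by (metis dist_commute dist_norm mem_ball)
      moreover have "ball (x \<tau>) d \<inter> S = {}"
        using nearest by (force simp: dist_norm norm_minus_commute)
      then have "ball (x \<tau>) d \<subseteq> inside S"
        using x \<open>d > 0\<close> by (intro connected_subset_inside[of _ _ "x \<tau>"]) auto
      moreover have "c + (1 + h) *\<^sub>R (p - c) \<in> outside S"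
        using \<open>h > 0\<close> by (intro outside p) simp
      ultimately show False
        using inside_Int_outside by blast
    qed
    then have "m \<bullet> (p - c) \<ge> 0"
      using \<open>d > 0\<close> by (simp add: dm zero_le_mult_iff)
    then have le: "(norm (p - c))\<^sup>2 \<le> 2 * r * (m \<bullet> (p - c))"
      using bound[OF m] by simp
    \<comment> \<open>\<open>A\<close> is the distance from \<open>c\<close> to
      \<open>x \<tau>\<close>, and \<open>k\<close> is the cosine of the angle between
      \<open>u\<close> and \<open>m\<close>, so \<open>1 - k\<close> measures the failure of
      \<open>m = u\<close>.\<close>
    define A where "A = 2 * r - \<tau>"
    define k where "k = u \<bullet> m"
    have mm: "m \<bullet> m = 1" and uu: "u \<bullet> u = 1"
      using surface_normal_norm[OF m] u(1) by (simp_all add: norm_eq_1)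
    have "k \<le> 1"
      using norm_cauchy_schwarz[of u m] surface_normal_norm[OF m] u(1) by (simp add: k_def)
    have "p - c = (p - x \<tau>) + (x \<tau> - c)"
      by simp
    also have "\<dots> = d *\<^sub>R m + A *\<^sub>R u"
      unfolding dm by (simp add: x_def A_def)
    finally have pc: "p - c = d *\<^sub>R m + A *\<^sub>R u" .
    have "A\<^sup>2 + 2 * A * d * k + d\<^sup>2 \<le> 2 * r * (d + A * k)"
    proof -
      have "(norm (d *\<^sub>R m + A *\<^sub>R u))\<^sup>2 = d * d * (m \<bullet> m) + d * A * (m \<bullet> u) + A * d * (u \<bullet> m) + A * A * (u \<bullet> u)"
        by (simp add: power2_norm_eq_inner inner_add_left inner_add_right algebra_simps)
      then have "(norm (d *\<^sub>R m + A *\<^sub>R u))\<^sup>2 = A\<^sup>2 + 2 * A * d * k + d\<^sup>2"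
        by (simp add: mm uu k_def inner_commute[of m u] power2_eq_square)
      moreover have "m \<bullet> (d *\<^sub>R m + A *\<^sub>R u) = d + A * k"
        by (simp add: inner_add_right mm k_def inner_commute[of m u])
      ultimately show ?thesis
        using le by (simp only: pc)
    qed
    \<comment> \<open>The right side is \<open>(A + d) * (2 * r - (A + d))\<close>, where
      \<open>A + d = 2 * r - e\<close>.\<close>
    then have "2 * A * ((r - d) * (1 - k)) \<le> 2 * r * e - e\<^sup>2"
      by (simp add: A_def e_def power2_eq_square algebra_simps)
    then have "2 * A * ((r - d) * (1 - k)) \<le> 2 * r * e"
      using zero_le_power2[of e] by linarith
    moreover have "2 * r * ((r - d) * (1 - k)) \<le> 2 * A * ((r - d) * (1 - k))"
      using \<tau> T \<open>e > 0\<close> \<open>k \<le> 1\<close> by (intro mult_right_mono mult_nonneg_nonneg) (auto simp: A_def e_def)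
    ultimately have "2 * r * ((r - d) * (1 - k)) \<le> 2 * r * e"
      by linarith
    then have "(r - d) * (1 - k) \<le> e"
      using \<open>0 < r\<close> by simp
    moreover have "(r - T) * (1 - k) \<le> (r - d) * (1 - k)"
      using \<tau> \<open>e > 0\<close> \<open>k \<le> 1\<close> by (intro mult_right_mono) (auto simp: e_def)
    ultimately have k_le: "(r - T) * (1 - k) \<le> e"
      by linarith
    \<comment> \<open>The derivative of \<open>H (t, p)\<close> in \<open>t\<close> at
      \<open>\<tau>\<close> has the sign of \<open>(1 - k) - C * e\<close>. As \<open>\<tau>\<close>
      may equal \<open>T\<close>, the maximum is compared only with smaller parameters, available
      because \<open>\<tau> > 0\<close>.\<close>
    have "\<not> (1 - k) - C * e < 0"
    proof
      assume neg: "(1 - k) - C * e < 0"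
      define q where "q = p - c - (2 * r) *\<^sub>R u"
      define f where "f = (\<lambda>t. (t - sqrt (q \<bullet> q + 2 * t * (q \<bullet> u) + t\<^sup>2)) * exp (- (C * t)))"
      have px: "p - x t = q + t *\<^sub>R u" for t
        by (simp add: q_def x_def algebra_simps)
      have sq_norm: "q \<bullet> q + 2 * t * (q \<bullet> u) + t\<^sup>2 = (norm (p - x t))\<^sup>2" for t
      proof -
        have "(q + t *\<^sub>R u) \<bullet> (q + t *\<^sub>R u)
            = q \<bullet> q + t * (q \<bullet> u) + t * (u \<bullet> q) + t * t * (u \<bullet> u)"
          by (simp add: inner_add_left inner_add_right algebra_simps)
        then show ?thesis
          unfolding px power2_norm_eq_inner by (simp add: uu inner_commute[of u q] power2_eq_square)
      qed
      have Hf: "H (t, p) = f t" for t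
        by (simp add: H_def f_def sq_norm)
      have d2: "q \<bullet> q + 2 * \<tau> * (q \<bullet> u) + \<tau>\<^sup>2 = d\<^sup>2"
        by (simp add: sq_norm d_def)
      have "u \<bullet> (d *\<^sub>R m) = u \<bullet> q + \<tau>"
        unfolding dm[symmetric] px by (simp add: inner_add_right uu)
      then have qu: "q \<bullet> u + \<tau> = d * k"
        by (simp add: k_def inner_commute)
      have sqrt: "(sqrt has_real_derivative inverse (sqrt (d\<^sup>2)) / 2)
          (at (q \<bullet> q + 2 * \<tau> * (q \<bullet> u) + \<tau>\<^sup>2))"
        unfolding d2 using \<open>d > 0\<close> by (intro DERIV_real_sqrt) simp
      have "((\<lambda>t. q \<bullet> q + 2 * t * (q \<bullet> u) + t\<^sup>2) has_real_derivative 2 * (d * k)) (at \<tau>)"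
        by (auto intro!: derivative_eq_intros simp: qu[symmetric])
      with sqrt have "((\<lambda>t. sqrt (q \<bullet> q + 2 * t * (q \<bullet> u) + t\<^sup>2)) has_real_derivative
          inverse (sqrt (d\<^sup>2)) / 2 * (2 * (d * k))) (at \<tau>)"
        by (rule DERIV_chain2)
      moreover have "inverse (sqrt (d\<^sup>2)) / 2 * (2 * (d * k)) = k"
        using \<open>d > 0\<close> by simp
      ultimately have sq: "((\<lambda>t. sqrt (q \<bullet> q + 2 * t * (q \<bullet> u) + t\<^sup>2)) has_real_derivative k) (at \<tau>)"
        by (simp only:)
      have "((\<lambda>t. exp (- (C * t))) has_real_derivative exp (- (C * \<tau>)) * - C) (at \<tau>)"
        by (auto intro!: derivative_eq_intros)
      then have "(f has_real_derivative (1 - k) * exp (- (C * \<tau>))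
          + exp (- (C * \<tau>)) * - C * (\<tau> - sqrt (q \<bullet> q + 2 * \<tau> * (q \<bullet> u) + \<tau>\<^sup>2))) (at \<tau>)"
        unfolding f_def by (intro DERIV_mult DERIV_diff DERIV_ident sq)
      moreover have "(1 - k) * exp (- (C * \<tau>))
          + exp (- (C * \<tau>)) * - C * (\<tau> - sqrt (q \<bullet> q + 2 * \<tau> * (q \<bullet> u) + \<tau>\<^sup>2))
          = ((1 - k) - C * e) * exp (- (C * \<tau>))"
        using \<open>d > 0\<close> unfolding d2 by (simp add: e_def algebra_simps)
      ultimately have "(f has_real_derivative ((1 - k) - C * e) * exp (- (C * \<tau>))) (at \<tau>)"
        by (simp only:)
      moreover have "((1 - k) - C * e) * exp (- (C * \<tau>)) < 0"
        using neg by (simp add: mult_neg_pos)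
      ultimately obtain \<delta> where \<delta>: "\<delta> > 0" "\<And>h. \<lbrakk>h > 0; h < \<delta>\<rbrakk> \<Longrightarrow> f \<tau> < f (\<tau> - h)"
        using DERIV_neg_dec_left by blast
      define h where "h = min (\<delta> / 2) \<tau>"
      have "h > 0" "h < \<delta>" "h \<le> \<tau>"
        using \<delta>(1) \<open>\<tau> > 0\<close> by (auto simp: h_def)
      then have "H (\<tau>, p) < H (\<tau> - h, p)"
        using \<delta>(2)[of h] by (simp add: Hf)
      then show False
        using max[of "\<tau> - h" p] \<tau> p \<open>h > 0\<close> \<open>h \<le> \<tau>\<close> by simp
    qed
    \<comment> \<open>Here the factor 2 in \<open>C\<close> acts:
      \<open>2 * e \<le> (r - T) * (1 - k) \<le> e\<close>.\<close>
    then have "C * e \<le> 1 - k"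
      by simp
    then have "(r - T) * (C * e) \<le> (r - T) * (1 - k)"
      using T by (intro mult_left_mono) auto
    moreover have "(r - T) * (C * e) = 2 * e"
      using T by (simp add: C_def)
    ultimately show False
      using k_le \<open>e > 0\<close> by linarith
  qed
  show "ball (c + (2 * r - T) *\<^sub>R u) T \<inter> S = {}"
  proof -
    have "T \<le> norm (q - x T)" if "q \<in> S" for q
      using H_le[OF that] by (simp add: H_def mult_le_0_iff not_le)
    then show ?thesis
      by (force simp: x_def dist_norm norm_minus_commute)
  qed
  show "c + (2 * r - T) *\<^sub>R u \<in> inside S"
    using T by (rule x_inside)
qed

section \<open>The farthest point and the passage to radius one\<close>

theorem theorem1:
  fixes S :: "(real^3) set" and c :: "real^3"
  assumes "S homeomorphic sphere (0::real^3) 1"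
    and "smooth_embedded_surface S"
    and "normal_curvatures_bounded_by S 1"
    and "S \<subseteq> ball c 2"
  shows "\<exists>x. cball x 1 \<subseteq> region_bounded_by S"
proof -
  have "compact S"
    using homeomorphic_compactness[OF assms(1)] by simp
  have "connected S"
    using homeomorphic_connectedness[OF assms(1)] connected_sphere[of "0::real^3" 1] by simp
  have "S \<noteq> {}"
    using assms(1) by (auto simp: homeomorphic_empty)
  \<comment> \<open>Otherwise the whole complement would be \<open>outside S\<close>, which is
    connected, against Jordan-Brouwer separation.\<close>
  have "inside S \<noteq> {}"
  proof
    assume "inside S = {}"
    then have "outside S = - S"
      using inside_Un_outside[of S] by simp
    moreover have "connected (outside S)"
      using \<open>compact S\<close> by (intro connected_outside compact_imp_bounded) auto
    ultimately show False
      using Jordan_Brouwer_separation[OF assms(1)] by simp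
  qed
  obtain p where p: "p \<in> S" "\<And>q. q \<in> S \<Longrightarrow> dist c q \<le> dist c p"
    using distance_attains_sup[OF \<open>compact S\<close> \<open>S \<noteq> {}\<close>] by blast
  define \<rho> where "\<rho> = dist c p"
  have \<rho>: "\<rho> < 2" "\<rho> \<ge> 0"
    using p(1) assms(4) by (auto simp: \<rho>_def)
  obtain u where u: "norm u = 1" "p - c = \<rho> *\<^sub>R u"
  proof (cases "p = c")
    case True
    then show ?thesis
      using that[of "axis 1 1"] by (simp add: \<rho>_def)
  next
    case False
    then show ?thesis
      using that[of "sgn (p - c)"] by (simp add: \<rho>_def dist_norm norm_minus_commute norm_sgn sgn_div_norm)
  qed
  have ball_inside: "ball (p - T *\<^sub>R u) T \<subseteq> inside S" if T: "0 < T" "T < 1" for T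
  proof -
    \<comment> \<open>With \<open>r > \<rho> / 2\<close> the new centre \<open>c'\<close> lies
      behind \<open>c\<close> as seen from \<open>p\<close>. Its ball of radius \<open>2 * r\<close>
      contains the ball of radius \<open>\<rho>\<close> about \<open>c\<close>, and \<open>p\<close>
      stays on its boundary.\<close>
    obtain r where r: "max T (\<rho> / 2) < r" "r < 1"
      using dense[of "max T (\<rho> / 2)" 1] T(2) \<rho>(1) by auto
    define c' where "c' = p - (2 * r) *\<^sub>R u"
    have p_eq: "c' + (2 * r) *\<^sub>R u = p" "c' + (2 * r - T) *\<^sub>R u = p - T *\<^sub>R u"
      by (simp_all add: c'_def algebra_simps)
    have "c - c' = (2 * r - \<rho>) *\<^sub>R u"
      using u(2) by (simp add: c'_def algebra_simps)
    then have "dist c c' = 2 * r - \<rho>"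
      using u(1) r(1) by (simp add: dist_norm)
    then have "dist c' q \<le> 2 * r" if "q \<in> S" for q
      using dist_triangle3[of c' q c] p(2)[OF that] by (simp add: \<rho>_def)
    then have "S \<subseteq> cball c' (2 * r)"
      by auto
    note disj = tangent_ball_disjoint[OF \<open>compact S\<close> assms(2,3) \<open>connected S\<close> \<open>inside S \<noteq> {}\<close>
        r(2) this u(1), of T, unfolded p_eq, OF p(1) T(1)]
    show ?thesis
      using connected_subset_inside[OF connected_ball disj(1) _ disj(2)] r(1) T(1) by simp
  qed
  have "ball (p - u) 1 \<subseteq> inside S"
  proof
    fix z assume "z \<in> ball (p - u) 1"
    then have z: "norm (z - (p - u)) < 1"
      by (simp add: dist_norm norm_minus_commute)
    \<comment> \<open>Moving the centre from \<open>p - u\<close> to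
      \<open>p - T *\<^sub>R u\<close> costs \<open>1 - T\<close>, so
      \<open>2 * T > 1 + norm (z - (p - u))\<close> is required. The choice is the midpoint between
      this threshold for \<open>T\<close> and 1.\<close>
    define T where "T = (3 + norm (z - (p - u))) / 4"
    have T4: "4 * T = 3 + norm (z - (p - u))"
      by (simp add: T_def)
    have T: "0 < T" "T < 1"
      using z T4 norm_ge_zero[of "z - (p - u)"] by linarith+
    have "z - (p - T *\<^sub>R u) = (z - (p - u)) - (1 - T) *\<^sub>R u"
      by (simp add: algebra_simps)
    then have "norm (z - (p - T *\<^sub>R u)) \<le> norm (z - (p - u)) + norm ((1 - T) *\<^sub>R u)"
      using norm_triangle_ineq4 by metis
    also have "norm ((1 - T) *\<^sub>R u) = 1 - T"
      using T u(1) by simp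
    finally have "norm (z - (p - T *\<^sub>R u)) < T"
      using z T4 by linarith
    then show "z \<in> inside S"
      using ball_inside[OF T] by (auto simp: dist_norm norm_minus_commute)
  qed
  then have "closure (ball (p - u) 1) \<subseteq> closure (inside S)"
    by (rule closure_mono)
  also have "\<dots> \<subseteq> S \<union> inside S"
    using \<open>compact S\<close> by (intro closure_inside_subset compact_imp_closed)
  finally have "cball (p - u) 1 \<subseteq> region_bounded_by S"
    by (auto simp: region_bounded_by_def)
  then show ?thesis ..
qed

end
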